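(* Suppose that $f(\cdot;\xi)$ is convex and $L$-smooth for every realization of $\xi$ (with $L>0$), that $F$ has a minimizer $w_*$, and that there is $\sigma_*>0$ with $\mathbb{E}[\|\nabla f(w_*;\xi)\|^2]\le\sigma_*^2$. Let $M>0$, $N>0$, $\epsilon>0$, and consider iSARAH started at $\tilde w_0\in\mathbb{R}^d$ with $$\eta=\frac{2}{5L},\qquad m=\max\left\{40LM-1,\ \frac{120LN}{\epsilon}-1\right\},\qquad b=\max\left\{40LM-5,\ \frac{120LN}{\epsilon},\ \frac{60\sigma_*^2}{\epsilon}\right\}$$ ($m$ and $b$ rounded up to integers if necessary). Suppose its outer iterates $\tilde w_0,\dots,\tilde w_{\mathcal{T}}$ satisfy $$F(\tilde w_k)-F(w_* )\le M\|\nabla F(\tilde w_k)\|^2+N,\qquad k=0,\dots,\mathcal{T}.$$ Then the total work complexity to achieve $\mathbb{E}[\|\nabla F(\tilde w_s)\|^2]\le\epsilon$ is $$(b+m)s=\mathcal{O}\left(\max\left\{LM,\ \frac{\max\{LN,\sigma_*^2\}}{\epsilon}\right\}\log\left(\frac1\epsilon\right)\right).$$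
   Context: $\xi$ is a random variable; for each realization, $f(\cdot;\xi):\mathbb{R}^d\to\mathbb{R}$ is differentiable; $F(w)=\mathbb{E}[f(w;\xi)]$ is bounded below, and $\mathbb{E}[\nabla f(w;\xi)]=\nabla F(w)$ for every fixed $w\in\mathbb{R}^d$. $\|\cdot\|$ is the Euclidean norm. $L$-smooth for every realization means $\|\nabla f(w;\xi)-\nabla f(w';\xi)\|\le L\|w-w'\|$ for all $w,w'\in\mathbb{R}^d$ and every realization of $\xi$. The procedure iSARAH-IN$(w_0,\eta,m,b)$ has parameters $\eta>0$ and positive integers $m,b$. Let $\zeta_1,\dots,\zeta_b,\xi_1,\xi_2,\dots$ be i.i.d. copies of $\xi$, independent of $w_0$. Set $$v_0=\frac1b\sum_{i=1}^b\nabla f(w_0;\zeta_i),\qquad w_1=w_0-\eta v_0,$$ and for $t\ge 1$ $$v_t=\nabla f(w_t;\xi_t)-\nabla f(w_{t-1};\xi_t)+v_{t-1},\qquad w_{t+1}=w_t-\eta v_t.$$ The output is $\tilde w=w_t$ with $t$ chosen uniformly at random from $\{0,1,\dots,m\}$, independently of everything else. iSARAH with parameters $\eta,m,b$ and a given (deterministic) starting point $\tilde w_0$ produces outer iterates $\tilde w_s=\text{iSARAH-IN}(\tilde w_{s-1},\eta,m,b)$ for $s=1,\dots,\mathcal{T}$, using fresh independent randomness in each call. The condition with $M,N$ on the (random) outer iterates is understood to hold almost surely, with deterministic constants $M,N$ not depending on $\epsilon$, and $\mathcal{T}$ is at least the number $s$ of outer iterations used. The total work complexity is the number of stochastic gradient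 evaluations, which up to a constant factor is $(b+m)s$, where $s$ is the number of outer iterations used. The claim means: for sufficiently small $\epsilon$ there is a number $s$ of outer iterations with $\mathbb{E}[\|\nabla F(\tilde w_s)\|^2]\le\epsilon$ and $(b+m)s$ bounded as stated; the constant hidden in $\mathcal{O}(\cdot)$ may depend on $\|\nabla F(\tilde w_0)\|^2$ but not on $\epsilon,L,M,N,\sigma_*$. *)

theory Defs
  imports "HOL-Probability.Probability"
begin

definition grad :: "('d::euclidean_space \<Rightarrow> real) \<Rightarrow> 'd \<Rightarrow> 'd" where
  "grad g w = (THE D. GDERIV g w :> D)"

(* Throughout, D is the distribution of the random variable xi and
   f w x stands for f(w; xi) at the realization xi = x; "every realization" means
   every x in space D. *)

definition sgrad :: "('d::euclidean_space \<Rightarrow> 'x \<Rightarrow> real) \<Rightarrow> 'd \<Rightarrow> 'x \<Rightarrow> 'd" where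
  "sgrad f w x = grad (\<lambda>u. f u x) w"

definition objective :: "'x measure \<Rightarrow> ('d::euclidean_space \<Rightarrow> 'x \<Rightarrow> real) \<Rightarrow> 'd \<Rightarrow> real" where
  "objective D f w = (\<integral>x. f w x \<partial>D)"

(* The integrability assumptions say that the expectations E[f(w; xi)] and
   E[grad f(w; xi)] exist; the Bochner integral would otherwise default to 0. *)
locale stochastic_objective = prob_space D
  for D :: "'x measure" and f :: "'d::euclidean_space \<Rightarrow> 'x \<Rightarrow> real" +
  assumes differentiable: "x \<in> space D \<Longrightarrow> (\<lambda>u. f u x) differentiable (at w)"
    and integrable_f: "integrable D (f w)"
    and integrable_sgrad: "integrable D (sgrad f w)"
    and unbiased: "GDERIV (objective D f) w :> (\<integral>x. sgrad f w x \<partial>D)"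
    and bounded_below: "bdd_below (range (objective D f))"

(* Inner loop along one sample path: the t-th entry is the pair (w_t, v_t).
   z i is the i-th sample of the initial batch, x t the sample used at step t. *)
primrec isarah_state ::
  "('d::euclidean_space \<Rightarrow> 'x \<Rightarrow> real) \<Rightarrow> real \<Rightarrow> nat \<Rightarrow> (nat \<Rightarrow> 'x) \<Rightarrow> (nat \<Rightarrow> 'x) \<Rightarrow> 'd
    \<Rightarrow> nat \<Rightarrow> 'd \<times> 'd" where
  "isarah_state f \<eta> b z x w0 0 = (w0, (1 / real b) *\<^sub>R (\<Sum>i=1..b. sgrad f w0 (z i)))"
| "isarah_state f \<eta> b z x w0 (Suc t) =
    (let (w, v) = isarah_state f \<eta> b z x w0 t; w' = w - \<eta> *\<^sub>R v
     in (w', sgrad f w' (x (Suc t)) - sgrad f w (x (Suc t)) + v))"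

definition isarah_in ::
  "('d::euclidean_space \<Rightarrow> 'x \<Rightarrow> real) \<Rightarrow> real \<Rightarrow> nat \<Rightarrow> (nat \<Rightarrow> 'x) \<Rightarrow> (nat \<Rightarrow> 'x) \<Rightarrow> nat
    \<Rightarrow> 'd \<Rightarrow> 'd" where
  "isarah_in f \<eta> b z x t w0 = fst (isarah_state f \<eta> b z x w0 t)"

(* Outer iterates along one sample path. Call s = 1, 2, ... uses the batch z s, the inner
   samples x s and the output index t s; the inner length m enters only through the
   distribution of t s, see isarah_randomness. *)
primrec isarah ::
  "('d::euclidean_space \<Rightarrow> 'x \<Rightarrow> real) \<Rightarrow> real \<Rightarrow> nat \<Rightarrow> (nat \<Rightarrow> nat \<Rightarrow> 'x) \<Rightarrow> (nat \<Rightarrow> nat \<Rightarrow> 'x)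
    \<Rightarrow> (nat \<Rightarrow> nat) \<Rightarrow> 'd \<Rightarrow> nat \<Rightarrow> 'd" where
  "isarah f \<eta> b z x t w0 0 = w0"
| "isarah f \<eta> b z x t w0 (Suc s) =
    isarah_in f \<eta> b (z (Suc s)) (x (Suc s)) (t (Suc s)) (isarah f \<eta> b z x t w0 s)"

definition isarah_iterate ::
  "('d::euclidean_space \<Rightarrow> 'x \<Rightarrow> real) \<Rightarrow> real \<Rightarrow> nat \<Rightarrow> (nat \<Rightarrow> nat \<Rightarrow> 'w \<Rightarrow> 'x)
    \<Rightarrow> (nat \<Rightarrow> nat \<Rightarrow> 'w \<Rightarrow> 'x) \<Rightarrow> (nat \<Rightarrow> 'w \<Rightarrow> nat) \<Rightarrow> 'd \<Rightarrow> nat \<Rightarrow> 'w \<Rightarrow> 'd" where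
  "isarah_iterate f \<eta> b \<zeta> \<xi> \<tau> w0 s \<omega> =
    isarah f \<eta> b (\<lambda>k i. \<zeta> k i \<omega>) (\<lambda>k t. \<xi> k t \<omega>) (\<lambda>k. \<tau> k \<omega>) w0 s"

datatype source = Batch nat nat | Inner nat nat | Output nat

definition sources :: "nat \<Rightarrow> nat \<Rightarrow> source set" where
  "sources b T = {Batch s i | s i. s \<in> {1..T} \<and> i \<in> {1..b}} \<union>
     {Inner s t | s t. s \<in> {1..T} \<and> 1 \<le> t} \<union> {Output s | s. s \<in> {1..T}}"

(* The randomness of T outer iterations on a probability space P. The samples and the
   output indices take values in different types, so their joint independence is stated
   through the generated sigma-algebras (as in indep_vars_def2) instead of indep_vars. *)
locale isarah_randomness = prob_space P
  for P :: "'w measure" and D :: "'x measure" and m b T :: nat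
    and \<zeta> \<xi> :: "nat \<Rightarrow> nat \<Rightarrow> 'w \<Rightarrow> 'x" and \<tau> :: "nat \<Rightarrow> 'w \<Rightarrow> nat" +
  assumes batch_measurable: "s \<in> {1..T} \<Longrightarrow> i \<in> {1..b} \<Longrightarrow> \<zeta> s i \<in> measurable P D"
    and batch_distr: "s \<in> {1..T} \<Longrightarrow> i \<in> {1..b} \<Longrightarrow> distr P D (\<zeta> s i) = D"
    and inner_measurable: "s \<in> {1..T} \<Longrightarrow> 1 \<le> t \<Longrightarrow> \<xi> s t \<in> measurable P D"
    and inner_distr: "s \<in> {1..T} \<Longrightarrow> 1 \<le> t \<Longrightarrow> distr P D (\<xi> s t) = D"
    and output_measurable: "s \<in> {1..T} \<Longrightarrow> \<tau> s \<in> measurable P (count_space UNIV)"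
    and output_distr: "s \<in> {1..T} \<Longrightarrow>
      distr P (count_space UNIV) (\<tau> s) = measure_pmf (pmf_of_set {0..m})"
    and independent: "indep_sets (\<lambda>j. case j of
        Batch s i \<Rightarrow> {\<zeta> s i -` A \<inter> space P | A. A \<in> sets D}
      | Inner s t \<Rightarrow> {\<xi> s t -` A \<inter> space P | A. A \<in> sets D}
      | Output s \<Rightarrow> {\<tau> s -` A \<inter> space P | A. A \<in> sets (count_space UNIV)}) (sources b T)"

definition isarah_m :: "real \<Rightarrow> real \<Rightarrow> real \<Rightarrow> real \<Rightarrow> nat" where
  "isarah_m L M N \<epsilon> = nat \<lceil>max (40 * L * M - 1) (120 * L * N / \<epsilon> - 1)\<rceil>"

definition isarah_b :: "real \<Rightarrow> real \<Rightarrow> real \<Rightarrow> real \<Rightarrow> real \<Rightarrow> nat" where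
  "isarah_b L M N \<sigma> \<epsilon> =
    nat \<lceil>max (40 * L * M - 5) (max (120 * L * N / \<epsilon>) (60 * \<sigma>\<^sup>2 / \<epsilon>))\<rceil>"

end

theory Submission
  imports Defs
begin

text \<open>
  Write \<open>g w\<close> for the squared norm of the gradient of the objective \<open>F\<close> at \<open>w\<close>. By co-coercivity of
  the sample gradients, the quantity \<open>(norm (v - grad F w))\<^sup>2 + (norm v)\<^sup>2 / 4\<close> is a supermartingale along an
  inner loop with step size \<open>2 / (5 L)\<close>, and the descent lemma bounds \<open>g (w\<^sub>t)\<close> by this quantity plus
  \<open>5 L (F (w\<^sub>t) - F (w\<^sub>t\<^sub>+\<^sub>1))\<close>. Summing over the inner loop, a call started at \<open>w\<close> returns a point whose
  expected \<open>g\<close> is at most \<open>5 L (F w - F wstar) / (m + 1) + g w / 4 + 5 V / (4 b)\<close>, where the variance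
  \<open>V\<close> of a sample gradient satisfies \<open>V + g w \<le> 4 L (F w - F wstar) + 2 \<sigma>\<^sup>2\<close>. With the prescribed
  \<open>m\<close> and \<open>b\<close> this is at most \<open>g w / 2 + \<epsilon> / 8\<close>, so about \<open>2 log\<^sub>2 (1 / \<epsilon>)\<close> calls suffice. All
  expectations along a run are taken as nonnegative integrals, which makes integrability a consequence of
  the estimate instead of a precondition.
\<close>

section \<open>Convex functions with Lipschitz gradient\<close>

lemma GDERIV_unique:
  fixes g :: "'d::euclidean_space \<Rightarrow> real"
  assumes "GDERIV g w :> A" "GDERIV g w :> B"
  shows "A = B"
proof -
  have "(\<lambda>h. h \<bullet> A) = (\<lambda>h. h \<bullet> B)"
    using assms unfolding gderiv_def by (rule has_derivative_unique)
  then show ?thesis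
    by (metis vector_eq_ldot)
qed

lemma grad_eq:
  fixes g :: "'d::euclidean_space \<Rightarrow> real"
  assumes "GDERIV g w :> A"
  shows "grad g w = A"
  unfolding grad_def using assms by (blast intro: GDERIV_unique)

text \<open>On a Euclidean space the derivative, a linear functional, is the inner product with the
  vector of its values on \<open>Basis\<close>. Hence the description in \<open>grad\<close> is well
  defined at every point of differentiability.\<close>

lemma GDERIV_grad:
  fixes g :: "'d::euclidean_space \<Rightarrow> real"
  assumes "g differentiable (at w)"
  shows "GDERIV g w :> grad g w"
proof -
  obtain g' where g': "(g has_derivative g') (at w)"
    using assms by (auto simp: differentiable_def)
  interpret bounded_linear g' using g' by (rule has_derivative_bounded_linear)
  have "g' = (\<lambda>h. h \<bullet> (\<Sum>b\<in>Basis. g' b *\<^sub>R b))"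
  proof
    fix h
    have "g' h = g' (\<Sum>b\<in>Basis. (h \<bullet> b) *\<^sub>R b)" by (simp add: euclidean_representation)
    also have "\<dots> = h \<bullet> (\<Sum>b\<in>Basis. g' b *\<^sub>R b)"
      by (simp add: sum scaleR inner_sum_right mult.commute)
    finally show "g' h = h \<bullet> (\<Sum>b\<in>Basis. g' b *\<^sub>R b)" .
  qed
  with g' have "GDERIV g w :> (\<Sum>b\<in>Basis. g' b *\<^sub>R b)"
    unfolding gderiv_def by metis
  then show ?thesis
    using grad_eq by metis
qed

lemma GDERIV_line:
  fixes g :: "'d::euclidean_space \<Rightarrow> real"
  assumes "GDERIV g (x + t *\<^sub>R d) :> A"
  shows "((\<lambda>t. g (x + t *\<^sub>R d)) has_real_derivative d \<bullet> A) (at t)"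
proof -
  have "((\<lambda>t. x + t *\<^sub>R d) has_derivative (\<lambda>h. h *\<^sub>R d)) (at t)"
    by (auto intro!: derivative_eq_intros)
  moreover have "(g has_derivative (\<lambda>h. h \<bullet> A)) (at (x + t *\<^sub>R d))"
    using assms by (simp only: gderiv_def)
  ultimately have "((\<lambda>t. g (x + t *\<^sub>R d)) has_derivative (\<lambda>h. (h *\<^sub>R d) \<bullet> A)) (at t)"
    by (rule has_derivative_compose)
  moreover have "(\<lambda>h. (h *\<^sub>R d) \<bullet> A) = (*) (d \<bullet> A)"
    by (simp add: fun_eq_iff)
  ultimately show ?thesis
    by (simp only: has_field_derivative_def)
qed

text \<open>By Cauchy-Schwarz and the Lipschitz bound, \<open>g\<close> minus its quadratic upper
  model is nonincreasing along the segment from \<open>x\<close> to \<open>y\<close>.\<close>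

lemma descent_lemma:
  fixes g :: "'d::euclidean_space \<Rightarrow> real"
  assumes deriv: "\<And>w. GDERIV g w :> g' w"
    and lip: "\<And>w w'. norm (g' w - g' w') \<le> L * norm (w - w')"
  shows "g y \<le> g x + g' x \<bullet> (y - x) + L / 2 * (norm (y - x))\<^sup>2"
proof -
  define d where "d = y - x"
  define h where "h t = g (x + t *\<^sub>R d) - t * (g' x \<bullet> d) - L / 2 * t\<^sup>2 * (norm d)\<^sup>2" for t
  have "h 1 \<le> h 0"
  proof (rule DERIV_nonpos_imp_nonincreasing[where f = h])
    fix t :: real assume t: "0 \<le> t"
    define D where "D = d \<bullet> g' (x + t *\<^sub>R d) - g' x \<bullet> d - L * t * (norm d)\<^sup>2"
    have "(h has_real_derivative D) (at t)"
      unfolding h_def D_def by (rule derivative_eq_intros GDERIV_line[OF deriv] refl | simp)+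
    moreover have "D \<le> 0"
    proof -
      have "(g' (x + t *\<^sub>R d) - g' x) \<bullet> d \<le> norm (g' (x + t *\<^sub>R d) - g' x) * norm d"
        by (rule norm_cauchy_schwarz)
      also have "\<dots> \<le> L * norm (t *\<^sub>R d) * norm d"
        using lip[of "x + t *\<^sub>R d" x] by (intro mult_right_mono) auto
      finally show ?thesis
        using t by (simp add: D_def power2_eq_square inner_diff_left inner_commute[of d] mult.assoc)
    qed
    ultimately show "\<exists>y. (h has_real_derivative y) (at t) \<and> y \<le> 0" by blast
  qed simp
  then show ?thesis
    by (simp add: h_def d_def)
qed

text \<open>Restriction to the line through \<open>x\<close> and \<open>y\<close> reduces this to
  the tangent inequality in one variable.\<close>

lemma convex_on_above_tangent_GDERIV:
  fixes g :: "'d::euclidean_space \<Rightarrow> real"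
  assumes "convex_on UNIV g" "GDERIV g x :> A"
  shows "g x + A \<bullet> (y - x) \<le> g y"
proof -
  have "convex_on UNIV (\<lambda>t::real. g (x + t *\<^sub>R (y - x)))"
  proof (rule convex_onI)
    fix t a b :: real assume t: "0 < t" "t < 1"
    have "x + ((1 - t) *\<^sub>R a + t *\<^sub>R b) *\<^sub>R (y - x)
        = (1 - t) *\<^sub>R (x + a *\<^sub>R (y - x)) + t *\<^sub>R (x + b *\<^sub>R (y - x))"
      by (simp add: algebra_simps)
    then show "g (x + ((1 - t) *\<^sub>R a + t *\<^sub>R b) *\<^sub>R (y - x))
        \<le> (1 - t) * g (x + a *\<^sub>R (y - x)) + t * g (x + b *\<^sub>R (y - x))"
      using convex_onD[OF assms(1), of t] t by simp
  qed simp
  moreover have "((\<lambda>t. g (x + t *\<^sub>R (y - x))) has_real_derivative (y - x) \<bullet> A) (at 0)"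
    by (rule GDERIV_line) (use assms(2) in simp)
  ultimately have "g (x + 1 *\<^sub>R (y - x)) - g (x + 0 *\<^sub>R (y - x)) \<ge> (y - x) \<bullet> A * (1 - 0)"
    by (intro convex_on_imp_above_tangent[where A = UNIV]) auto
  then show ?thesis by (simp add: inner_commute)
qed

text \<open>The tilted function \<open>u \<mapsto> g u - g' y \<bullet> u\<close> is minimal at \<open>y\<close>; compare its value there with the
  one after a gradient step of length \<open>1 / L\<close> from \<open>x\<close>.\<close>

lemma convex_smooth_lower_bound:
  fixes g :: "'d::euclidean_space \<Rightarrow> real"
  assumes cvx: "convex_on UNIV g" and L: "0 < L"
    and deriv: "\<And>w. GDERIV g w :> g' w"
    and lip: "\<And>w w'. norm (g' w - g' w') \<le> L * norm (w - w')"
  shows "(norm (g' x - g' y))\<^sup>2 \<le> 2 * L * (g x - g y - g' y \<bullet> (x - y))"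
proof -
  define r where "r = g' x - g' y"
  define u where "u = x - (1 / L) *\<^sub>R r"
  have "g u \<le> g x + g' x \<bullet> (u - x) + L / 2 * (norm (u - x))\<^sup>2"
    using deriv lip by (rule descent_lemma)
  moreover have "g y + g' y \<bullet> (u - y) \<le> g u"
    by (rule convex_on_above_tangent_GDERIV[OF cvx deriv])
  moreover have ux: "u - x = - (1 / L) *\<^sub>R r"
    by (simp add: u_def)
  then have "L / 2 * (norm (u - x))\<^sup>2 = (norm r)\<^sup>2 / (2 * L)"
    using L by (simp add: power_divide power2_eq_square)
  moreover have "g' x \<bullet> (u - x) - g' y \<bullet> (u - y) = - (norm r)\<^sup>2 / L - g' y \<bullet> (x - y)"
  proof -
    have "g' x \<bullet> (u - x) - g' y \<bullet> (u - y) = r \<bullet> (u - x) - g' y \<bullet> (x - y)"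
      by (simp add: r_def inner_diff_left inner_diff_right)
    also have "r \<bullet> (u - x) = - (norm r)\<^sup>2 / L"
      by (simp add: ux power2_norm_eq_inner)
    finally show ?thesis .
  qed
  ultimately have "g y - g x + g' y \<bullet> (x - y) \<le> (norm r)\<^sup>2 / (2 * L) - (norm r)\<^sup>2 / L"
    by linarith
  then have "(norm r)\<^sup>2 / (2 * L) \<le> g x - g y - g' y \<bullet> (x - y)"
    by (simp add: field_simps)
  then show ?thesis
    using L by (simp add: r_def field_simps)
qed

text \<open>Adding \<open>convex_smooth_lower_bound\<close> and its copy with \<open>x\<close> and
  \<open>y\<close> swapped cancels the function values.\<close>

lemma convex_smooth_cocoercive:
  fixes g :: "'d::euclidean_space \<Rightarrow> real"
  assumes "convex_on UNIV g" and "0 < L"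
    and "\<And>w. GDERIV g w :> g' w"
    and "\<And>w w'. norm (g' w - g' w') \<le> L * norm (w - w')"
  shows "(norm (g' x - g' y))\<^sup>2 \<le> L * ((g' x - g' y) \<bullet> (x - y))"
proof -
  have "(norm (g' x - g' y))\<^sup>2 + (norm (g' y - g' x))\<^sup>2
      \<le> 2 * L * (g x - g y - g' y \<bullet> (x - y)) + 2 * L * (g y - g x - g' x \<bullet> (y - x))"
    using convex_smooth_lower_bound[OF assms] by (intro add_mono)
  also have "\<dots> = 2 * (L * ((g' x - g' y) \<bullet> (x - y)))"
    by (simp add: inner_diff_left inner_diff_right algebra_simps)
  finally show ?thesis
    by (simp add: norm_minus_commute[of "g' y"])
qed

section \<open>Centered noise and joint measurability\<close>

text \<open>The cross term \<open>2 * (s \<bullet> Y x)\<close> integrates to zero. This Pythagorean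
  identity drives the variance computations below.\<close>

lemma (in prob_space) integral_norm_add_centered:
  fixes Y :: "'a \<Rightarrow> 'd::euclidean_space"
  assumes Y: "integrable M Y" "(\<integral>x. Y x \<partial>M) = 0" and Y2: "integrable M (\<lambda>x. (norm (Y x))\<^sup>2)"
  shows "integrable M (\<lambda>x. (norm (s + Y x))\<^sup>2)"
    and "(\<integral>x. (norm (s + Y x))\<^sup>2 \<partial>M) = (norm s)\<^sup>2 + (\<integral>x. (norm (Y x))\<^sup>2 \<partial>M)"
proof -
  have eq: "(norm (s + y))\<^sup>2 = (norm s)\<^sup>2 + 2 * (s \<bullet> y) + (norm y)\<^sup>2" for y
    by (simp add: power2_norm_eq_inner algebra_simps inner_commute)
  show "integrable M (\<lambda>x. (norm (s + Y x))\<^sup>2)"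
    unfolding eq using Y(1) Y2 by simp
  have "(\<integral>x. s \<bullet> Y x \<partial>M) = 0"
    using Y by simp
  with Y(1) Y2 show "(\<integral>x. (norm (s + Y x))\<^sup>2 \<partial>M) = (norm s)\<^sup>2 + (\<integral>x. (norm (Y x))\<^sup>2 \<partial>M)"
    unfolding eq by (simp add: prob_space)
qed

text \<open>Approximate the first argument by simple functions.\<close>

lemma measurable_Caratheodory:
  fixes h :: "'d::euclidean_space \<Rightarrow> 'x \<Rightarrow> 'e::euclidean_space"
  assumes meas: "\<And>w. h w \<in> borel_measurable M"
    and cont: "\<And>x. x \<in> space M \<Longrightarrow> continuous_on UNIV (\<lambda>w. h w x)"
  shows "(\<lambda>(w, x). h w x) \<in> borel_measurable (borel \<Otimes>\<^sub>M M)"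
proof -
  obtain q :: "nat \<Rightarrow> 'd \<Rightarrow> 'd"
    where q: "\<And>i. simple_function borel (q i)" "\<And>w. (\<lambda>i. q i w) \<longlonglongrightarrow> w"
    using borel_measurable_implies_sequence_metric[of "\<lambda>w::'d. w" borel 0] by auto
  show ?thesis
  proof (rule borel_measurable_LIMSEQ_metric)
    fix i
    have "(\<lambda>p. h (q i (fst p)) (snd p)) \<in> borel_measurable (borel \<Otimes>\<^sub>M M)"
    \<comment> \<open>A simple function \<open>q i\<close> has finite range, so it suffices to treat
      each of its values \<open>v\<close> separately.\<close>
    proof (rule measurable_compose_countable'[where f = "\<lambda>v p. h v (snd p)" and g = "\<lambda>p. q i (fst p)"
          and I = "range (q i)"])
      show "(\<lambda>p. h v (snd p)) \<in> borel_measurable (borel \<Otimes>\<^sub>M M)" for v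
        using meas by measurable
      show "countable (range (q i))"
        using q(1)[of i] by (simp add: simple_function_def countable_finite)
      show "(\<lambda>p. q i (fst p)) \<in> measurable (borel \<Otimes>\<^sub>M M) (count_space (range (q i)))"
      proof (rule measurable_compose[OF measurable_fst])
        show "q i \<in> measurable borel (count_space (range (q i)))"
          using q(1)[of i] by (auto simp: simple_function_def measurable_count_space_eq2)
      qed
    qed
    then show "(\<lambda>(w, x). h (q i w) x) \<in> borel_measurable (borel \<Otimes>\<^sub>M M)"
      by (simp add: case_prod_unfold)
  next
    fix p :: "'d \<times> 'x" assume "p \<in> space (borel \<Otimes>\<^sub>M M)"
    then have "snd p \<in> space M" by (auto simp: space_pair_measure)
    then have "isCont (\<lambda>w. h w (snd p)) (fst p)"
      using cont by (simp add: continuous_on_eq_continuous_at)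
    then have "(\<lambda>i. h (q i (fst p)) (snd p)) \<longlonglongrightarrow> h (fst p) (snd p)"
      by (rule isCont_tendsto_compose[OF _ q(2)])
    then show "(\<lambda>i. case p of (w, x) \<Rightarrow> h (q i w) x) \<longlonglongrightarrow> (case p of (w, x) \<Rightarrow> h w x)"
      by (simp add: case_prod_unfold)
  qed
qed

section \<open>Smooth convex stochastic objectives\<close>

text \<open>\<open>integrable_noise\<close> gives \<open>noise_le\<close> its meaning: without it
  the Bochner integral could be 0 by default.\<close>

locale smooth_convex_objective = stochastic_objective D f
  for D :: "'x measure" and f :: "'d::euclidean_space \<Rightarrow> 'x \<Rightarrow> real" +
  fixes L \<sigma> :: real and wstar :: 'd
  assumes L_pos: "0 < L"
    and convex: "x \<in> space D \<Longrightarrow> convex_on UNIV (\<lambda>w. f w x)"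
    and smooth: "x \<in> space D \<Longrightarrow> norm (sgrad f w x - sgrad f w' x) \<le> L * norm (w - w')"
    and minimizer: "objective D f wstar \<le> objective D f w"
    and integrable_noise: "integrable D (\<lambda>x. (norm (sgrad f wstar x))\<^sup>2)"
    and noise_le: "(\<integral>x. (norm (sgrad f wstar x))\<^sup>2 \<partial>D) \<le> \<sigma>\<^sup>2"
begin

text \<open>The gradient of the objective, written as the mean sample gradient;
  \<open>unbiased\<close> identifies the two.\<close>

definition gradF :: "'d \<Rightarrow> 'd" where
  "gradF w = (\<integral>x. sgrad f w x \<partial>D)"

definition gap :: "'d \<Rightarrow> real" where
  "gap w = objective D f w - objective D f wstar"

definition noise_var :: "'d \<Rightarrow> real" where
  "noise_var w = (\<integral>x. (norm (sgrad f w x - gradF w))\<^sup>2 \<partial>D)"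

text \<open>Lyapunov function of the inner loop: squared estimation error plus a multiple of the
  squared estimator. By \<open>estimator_step\<close> one step lowers the squared norm of the
  estimator by at least four times the squared sample increment; the weight 1/4 turns this into an
  amount that pays for the growth of the error.\<close>

definition energy :: "'d \<Rightarrow> 'd \<Rightarrow> real" where
  "energy w v = (norm (v - gradF w))\<^sup>2 + (norm v)\<^sup>2 / 4"

lemma gap_nonneg: "0 \<le> gap w"
  using minimizer by (simp add: gap_def)

lemma noise_var_nonneg: "0 \<le> noise_var w"
  by (simp add: noise_var_def)

lemma energy_nonneg: "0 \<le> energy w v"
  by (simp add: energy_def)

lemma GDERIV_objective: "GDERIV (objective D f) w :> gradF w"
  unfolding gradF_def by (rule unbiased)

lemma grad_objective: "grad (objective D f) = gradF"
  by (rule ext) (rule grad_eq[OF GDERIV_objective])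

lemma GDERIV_sample: "x \<in> space D \<Longrightarrow> GDERIV (\<lambda>u. f u x) w :> sgrad f w x"
  unfolding sgrad_def by (intro GDERIV_grad differentiable)

lemma gradF_lipschitz: "norm (gradF w - gradF w') \<le> L * norm (w - w')"
proof -
  have "norm (gradF w - gradF w') = norm (\<integral>x. sgrad f w x - sgrad f w' x \<partial>D)"
    by (simp add: gradF_def integrable_sgrad)
  also have "\<dots> \<le> (\<integral>x. norm (sgrad f w x - sgrad f w' x) \<partial>D)"
    by (rule integral_norm_bound)
  also have "\<dots> \<le> (\<integral>x. L * norm (w - w') \<partial>D)"
    by (intro integral_mono integrable_norm Bochner_Integration.integrable_diff integrable_sgrad
        integrable_const smooth)
  finally show ?thesis by (simp add: prob_space)
qed

lemma gradF_wstar: "gradF wstar = 0"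
proof -
  have "(\<lambda>h. h \<bullet> gradF wstar) = (\<lambda>h. 0)"
    using GDERIV_objective[of wstar] minimizer unfolding gderiv_def
    by (intro has_derivative_local_min) (auto intro: always_eventually)
  then have "gradF wstar \<bullet> gradF wstar = 0" by metis
  then show ?thesis by simp
qed

lemma continuous_on_gradF: "continuous_on UNIV gradF"
  using gradF_lipschitz L_pos
  by (intro lipschitz_on_continuous_on[of L] lipschitz_onI) (auto simp: dist_norm)

lemma continuous_on_sgrad:
  assumes "x \<in> space D" shows "continuous_on UNIV (\<lambda>w. sgrad f w x)"
  using smooth[OF assms] L_pos
  by (intro lipschitz_on_continuous_on[of L] lipschitz_onI) (auto simp: dist_norm)

lemma continuous_on_objective: "continuous_on UNIV (objective D f)"
  using GDERIV_objective unfolding gderiv_def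
  by (auto intro!: has_derivative_continuous_on simp: continuous_on_eq_continuous_at
      intro: has_derivative_continuous)

lemma measurable_gradF [measurable]: "gradF \<in> borel_measurable borel"
  by (rule borel_measurable_continuous_onI[OF continuous_on_gradF])

lemma measurable_gap [measurable]: "gap \<in> borel_measurable borel"
proof -
  have [measurable]: "objective D f \<in> borel_measurable borel"
    by (rule borel_measurable_continuous_onI[OF continuous_on_objective])
  show ?thesis unfolding gap_def[abs_def] by measurable
qed

text \<open>Point and sample are both random along a run, which calls for joint measurability; it
  follows from Lipschitz continuity in the point.\<close>

lemma measurable_sgrad [measurable]: "(\<lambda>(w, x). sgrad f w x) \<in> borel_measurable (borel \<Otimes>\<^sub>M D)"
  by (intro measurable_Caratheodory continuous_on_sgrad borel_measurable_integrable integrable_sgrad)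

lemma measurable_sgrad_compose [measurable (raw)]:
  assumes "u \<in> borel_measurable M" "y \<in> measurable M D"
  shows "(\<lambda>\<omega>. sgrad f (u \<omega>) (y \<omega>)) \<in> borel_measurable M"
  using measurable_compose[OF measurable_Pair[OF assms] measurable_sgrad] by simp

lemma measurable_noise_var [measurable]: "noise_var \<in> borel_measurable borel"
  unfolding noise_var_def[abs_def] by measurable

lemma measurable_energy [measurable]:
  "(\<lambda>p. energy (fst p) (snd p)) \<in> borel_measurable (borel \<Otimes>\<^sub>M borel)"
  unfolding energy_def by measurable

section \<open>Second moments and variance of the sample gradients\<close>

text \<open>The gradient at \<open>w\<close> is compared with the one at \<open>wstar\<close>:
  \<open>convex_smooth_lower_bound\<close> controls their difference by a Bregman distance, whose
  mean is the gap because the mean gradient at \<open>wstar\<close> vanishes.\<close>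

lemma sgrad_square_le:
  assumes "x \<in> space D"
  shows "(norm (sgrad f w x))\<^sup>2
    \<le> 4 * L * (f w x - f wstar x - sgrad f wstar x \<bullet> (w - wstar)) + 2 * (norm (sgrad f wstar x))\<^sup>2"
proof -
  have "(norm (a + b))\<^sup>2 \<le> 2 * (norm a)\<^sup>2 + 2 * (norm b)\<^sup>2" for a b :: 'd
  proof -
    have "(norm (a + b))\<^sup>2 + (norm (a - b))\<^sup>2 = 2 * (norm a)\<^sup>2 + 2 * (norm b)\<^sup>2"
      by (simp add: power2_norm_eq_inner inner_add_left inner_add_right inner_diff_left inner_diff_right)
    then show ?thesis by (smt (verit) zero_le_power2)
  qed
  from this[of "sgrad f w x - sgrad f wstar x" "sgrad f wstar x"]
  have "(norm (sgrad f w x))\<^sup>2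
      \<le> 2 * (norm (sgrad f w x - sgrad f wstar x))\<^sup>2 + 2 * (norm (sgrad f wstar x))\<^sup>2"
    by simp
  moreover have "(norm (sgrad f w x - sgrad f wstar x))\<^sup>2
      \<le> 2 * L * (f w x - f wstar x - sgrad f wstar x \<bullet> (w - wstar))"
    using convex[OF assms] L_pos GDERIV_sample[OF assms] smooth[OF assms]
    by (rule convex_smooth_lower_bound)
  ultimately show ?thesis by linarith
qed

text \<open>Square integrability is assumed at \<open>wstar\<close> only;
  \<open>sgrad_square_le\<close> provides an integrable majorant elsewhere.\<close>

lemma integrable_sgrad_square: "integrable D (\<lambda>x. (norm (sgrad f w x))\<^sup>2)"
proof (rule Bochner_Integration.integrable_bound)
  show "integrable D (\<lambda>x. 4 * L * (f w x - f wstar x - sgrad f wstar x \<bullet> (w - wstar))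
      + 2 * (norm (sgrad f wstar x))\<^sup>2)"
    using integrable_f integrable_sgrad integrable_noise by simp
  show "AE x in D. norm ((norm (sgrad f w x))\<^sup>2) \<le> norm (4 * L * (f w x - f wstar x
      - sgrad f wstar x \<bullet> (w - wstar)) + 2 * (norm (sgrad f wstar x))\<^sup>2)"
    by (intro AE_I2) (simp add: order_trans[OF sgrad_square_le abs_ge_self])
qed (use integrable_sgrad[of w] in measurable)

lemma integrable_centered:
  "integrable D (\<lambda>x. sgrad f w x - gradF w)"
  "(\<integral>x. sgrad f w x - gradF w \<partial>D) = 0"
  using integrable_sgrad by (simp_all add: gradF_def prob_space)

lemma integrable_centered_square: "integrable D (\<lambda>x. (norm (sgrad f w x - gradF w))\<^sup>2)"
proof -
  have "(norm (sgrad f w x - gradF w))\<^sup>2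
      = (norm (sgrad f w x))\<^sup>2 - 2 * (sgrad f w x \<bullet> gradF w) + (norm (gradF w))\<^sup>2" for x
    by (simp add: power2_norm_eq_inner inner_diff_left inner_diff_right inner_commute)
  then show ?thesis
    using integrable_sgrad_square integrable_sgrad by simp
qed

text \<open>The left side is the second moment of the sample gradient, so the integrated form of
  \<open>sgrad_square_le\<close> bounds it; \<open>gradF_wstar\<close> removes the linear
  term.\<close>

lemma noise_var_le:
  "noise_var w + (norm (gradF w))\<^sup>2 \<le> 4 * L * gap w + 2 * \<sigma>\<^sup>2"
proof -
  have "noise_var w + (norm (gradF w))\<^sup>2 = (\<integral>x. (norm (gradF w + (sgrad f w x - gradF w)))\<^sup>2 \<partial>D)"
    unfolding noise_var_def
    by (subst integral_norm_add_centered(2)[OF integrable_centered integrable_centered_square]) simp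
  also have "\<dots> = (\<integral>x. (norm (sgrad f w x))\<^sup>2 \<partial>D)"
    by simp
  also have "\<dots> \<le> (\<integral>x. 4 * L * (f w x - f wstar x - sgrad f wstar x \<bullet> (w - wstar))
      + 2 * (norm (sgrad f wstar x))\<^sup>2 \<partial>D)"
    using integrable_f integrable_sgrad integrable_noise
    by (intro integral_mono integrable_sgrad_square sgrad_square_le) auto
  also have "\<dots> = 4 * L * (gap w - gradF wstar \<bullet> (w - wstar))
      + 2 * (\<integral>x. (norm (sgrad f wstar x))\<^sup>2 \<partial>D)"
    using integrable_f integrable_sgrad integrable_noise
    by (simp add: gap_def objective_def gradF_def)
  also have "\<dots> \<le> 4 * L * gap w + 2 * \<sigma>\<^sup>2"
    using noise_le by (simp add: gradF_wstar)
  finally show ?thesis .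
qed

section \<open>One step of the inner loop\<close>

text \<open>The descent lemma is multiplied by \<open>5 * L\<close>, which gives the inner product
  of \<open>gradF w\<close> and \<open>v\<close> the coefficient 2 needed for polarization.\<close>

lemma gap_step:
  "(norm (gradF w))\<^sup>2 + 5 * L * gap (w - (2 / (5 * L)) *\<^sub>R v) \<le> 5 * L * gap w + energy w v"
proof -
  define \<eta> where "\<eta> = 2 / (5 * L)"
  have \<eta>: "5 * L * \<eta> = 2" "5 * L * (L * \<eta>\<^sup>2) = 4 / 5"
    using L_pos by (simp_all add: \<eta>_def power2_eq_square)
  have "objective D f (w - \<eta> *\<^sub>R v) \<le> objective D f w + gradF w \<bullet> (w - \<eta> *\<^sub>R v - w)
      + L / 2 * (norm (w - \<eta> *\<^sub>R v - w))\<^sup>2"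
    using GDERIV_objective gradF_lipschitz by (rule descent_lemma)
  then have "gap (w - \<eta> *\<^sub>R v) \<le> gap w - \<eta> * (gradF w \<bullet> v) + L * \<eta>\<^sup>2 / 2 * (norm v)\<^sup>2"
    by (simp add: gap_def power_mult_distrib)
  then have "5 * L * gap (w - \<eta> *\<^sub>R v)
      \<le> 5 * L * (gap w - \<eta> * (gradF w \<bullet> v) + L * \<eta>\<^sup>2 / 2 * (norm v)\<^sup>2)"
    using L_pos by (intro mult_left_mono) auto
  also have "\<dots> = 5 * L * gap w - (5 * L * \<eta>) * (gradF w \<bullet> v) + (5 * L * (L * \<eta>\<^sup>2)) / 2 * (norm v)\<^sup>2"
    by (simp add: algebra_simps)
  also have "\<dots> = 5 * L * gap w - 2 * (gradF w \<bullet> v) + 2 / 5 * (norm v)\<^sup>2"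
    unfolding \<eta> by simp
  \<comment> \<open>Polarization leaves the negative coefficient \<open>2 / 5 - 1\<close> in front
    of \<open>(norm v)\<^sup>2\<close>, so that term can be discarded.\<close>
  also have "2 * (gradF w \<bullet> v) = (norm (gradF w))\<^sup>2 + (norm v)\<^sup>2 - (norm (v - gradF w))\<^sup>2"
    by (simp add: power2_norm_eq_inner inner_diff_left inner_diff_right inner_commute)
  finally show ?thesis
    using zero_le_power2[of "norm v"] unfolding energy_def \<eta>_def by linarith
qed

text \<open>Co-coercivity of the increment \<open>r\<close>, with displacement
  \<open>- \<eta> *\<^sub>R v\<close> and \<open>L * \<eta> = 2 / 5\<close>, gives
  \<open>2 * (r \<bullet> v) \<le> - 5 * (norm r)\<^sup>2\<close>; expanding the square of
  \<open>r + v\<close> then leaves the factor 4.\<close>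

lemma estimator_step:
  assumes "x \<in> space D"
  shows "(norm (sgrad f (w - (2 / (5 * L)) *\<^sub>R v) x - sgrad f w x + v))\<^sup>2
    \<le> (norm v)\<^sup>2 - 4 * (norm (sgrad f (w - (2 / (5 * L)) *\<^sub>R v) x - sgrad f w x))\<^sup>2"
proof -
  define \<eta> where "\<eta> = 2 / (5 * L)"
  define r where "r = sgrad f (w - \<eta> *\<^sub>R v) x - sgrad f w x"
  have "(norm r)\<^sup>2 \<le> L * (r \<bullet> (w - \<eta> *\<^sub>R v - w))"
    unfolding r_def using convex[OF assms] L_pos GDERIV_sample[OF assms] smooth[OF assms]
    by (rule convex_smooth_cocoercive)
  also have "\<dots> = - 2 / 5 * (r \<bullet> v)"
    using L_pos by (simp add: \<eta>_def)
  finally have "(norm (r + v))\<^sup>2 \<le> (norm v)\<^sup>2 - 4 * (norm r)\<^sup>2"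
    by (simp add: power2_norm_eq_inner inner_add_left inner_add_right inner_commute)
  then show ?thesis unfolding r_def \<eta>_def .
qed

text \<open>The new error is the old one plus the centered increment \<open>Y\<close>, so its mean
  square grows by the variance of \<open>r\<close>. The decrease of
  \<open>(norm v)\<^sup>2 / 4\<close> from \<open>estimator_step\<close> is at least
  \<open>(norm r)\<^sup>2\<close> and compensates for this.\<close>

lemma energy_step:
  assumes w': "w' = w - (2 / (5 * L)) *\<^sub>R v"
  shows "(\<integral>\<^sup>+x. ennreal (energy w' (sgrad f w' x - sgrad f w x + v)) \<partial>D) \<le> ennreal (energy w v)"
proof -
  define r where "r x = sgrad f w' x - sgrad f w x" for x
  define \<mu> where "\<mu> = gradF w' - gradF w"
  define Y where "Y x = r x - \<mu>" for x
  have r: "integrable D r" "(\<integral>x. r x \<partial>D) = \<mu>"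
    using integrable_sgrad by (simp_all add: r_def[abs_def] \<mu>_def gradF_def)
  have Y: "integrable D Y" "(\<integral>x. Y x \<partial>D) = 0"
    using r by (simp_all add: Y_def[abs_def] prob_space)
  have r2: "integrable D (\<lambda>x. (norm (r x))\<^sup>2)"
  proof (rule integrable_const_bound)
    show "AE x in D. norm ((norm (r x))\<^sup>2) \<le> (L * norm (w' - w))\<^sup>2"
      using smooth by (intro AE_I2) (simp add: r_def power_mono)
  qed (use r(1) in measurable)
  have Y2: "integrable D (\<lambda>x. (norm (Y x))\<^sup>2)"
  proof -
    have "(norm (Y x))\<^sup>2 = (norm (r x))\<^sup>2 - 2 * (r x \<bullet> \<mu>) + (norm \<mu>)\<^sup>2" for x
      by (simp add: Y_def power2_norm_eq_inner inner_diff_left inner_diff_right inner_commute)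
    then show ?thesis using r r2 by simp
  qed
  note I = integral_norm_add_centered[OF Y Y2]
  have *: "(norm (v - gradF w + Y x))\<^sup>2 = (norm (r x + v - gradF w'))\<^sup>2" for x
    by (simp add: Y_def \<mu>_def algebra_simps)
  \<comment> \<open>The variance of \<open>r\<close> is at most its second moment: the shift in the
    Pythagorean identity is the mean \<open>\<mu>\<close>.\<close>
  have Y_le: "(\<integral>x. (norm (Y x))\<^sup>2 \<partial>D) \<le> (\<integral>x. (norm (r x))\<^sup>2 \<partial>D)"
    using I(2)[of \<mu>] by (simp add: Y_def)
  have int: "integrable D (\<lambda>x. (norm (v - gradF w + Y x))\<^sup>2 + (norm v)\<^sup>2 / 4 - (norm (r x))\<^sup>2)"
    using I(1) r2 by simp
  have le: "energy w' (r x + v)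
      \<le> (norm (v - gradF w + Y x))\<^sup>2 + (norm v)\<^sup>2 / 4 - (norm (r x))\<^sup>2" if "x \<in> space D" for x
    using estimator_step[OF that, of w v] unfolding energy_def * w'[symmetric] r_def by simp
  have "(\<integral>\<^sup>+x. ennreal (energy w' (r x + v)) \<partial>D)
      \<le> (\<integral>\<^sup>+x. ennreal ((norm (v - gradF w + Y x))\<^sup>2 + (norm v)\<^sup>2 / 4 - (norm (r x))\<^sup>2) \<partial>D)"
    using le by (intro nn_integral_mono ennreal_leI)
  \<comment> \<open>On \<open>space D\<close> the integrand dominates an energy, hence is
    nonnegative and \<open>ennreal\<close> truncates nothing.\<close>
  also have "\<dots> = ennreal (\<integral>x. (norm (v - gradF w + Y x))\<^sup>2 + (norm v)\<^sup>2 / 4 - (norm (r x))\<^sup>2 \<partial>D)"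
    using le energy_nonneg by (intro nn_integral_eq_integral int AE_I2) (meson order_trans)
  also have "(\<integral>x. (norm (v - gradF w + Y x))\<^sup>2 + (norm v)\<^sup>2 / 4 - (norm (r x))\<^sup>2 \<partial>D)
      = energy w v + (\<integral>x. (norm (Y x))\<^sup>2 \<partial>D) - (\<integral>x. (norm (r x))\<^sup>2 \<partial>D)"
    using I r2 by (simp add: energy_def prob_space)
  also have "\<dots> \<le> energy w v"
    using Y_le by simp
  finally show ?thesis
    by (simp add: r_def ennreal_leI)
qed

section \<open>Noise of the initial batch mean\<close>

text \<open>For the sum \<open>s\<close> of \<open>c\<close> centered sample gradients this is
  \<open>c\<^sup>2\<close> times the energy of the batch mean. Keeping \<open>c\<close> fixed while
  \<open>s\<close> grows sample by sample allows an induction over the batch.\<close>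

definition batch_energy :: "real \<Rightarrow> 'd \<Rightarrow> 'd \<Rightarrow> real" where
  "batch_energy c w s = (norm s)\<^sup>2 + (norm (s + c *\<^sub>R gradF w))\<^sup>2 / 4"

lemma batch_energy_nonneg: "0 \<le> batch_energy c w s"
  by (simp add: batch_energy_def)

lemma measurable_batch_energy [measurable (raw)]:
  assumes [measurable]: "u \<in> borel_measurable M" "s \<in> borel_measurable M"
  shows "(\<lambda>x. batch_energy c (u x) (s x)) \<in> borel_measurable M"
  unfolding batch_energy_def by measurable

text \<open>Both squared norms are those of a fixed vector plus a centered one, so each gains the
  variance, with weights 1 and 1/4.\<close>

lemma batch_energy_step:
  "(\<integral>\<^sup>+x. ennreal (batch_energy c w (s + (sgrad f w x - gradF w))) \<partial>D)
    = ennreal (batch_energy c w s + 5 / 4 * noise_var w)"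
proof -
  note I = integral_norm_add_centered[OF integrable_centered integrable_centered_square, of _ w]
  have eq: "batch_energy c w (s + (sgrad f w x - gradF w)) = (norm (s + (sgrad f w x - gradF w)))\<^sup>2
      + (norm ((s + c *\<^sub>R gradF w) + (sgrad f w x - gradF w)))\<^sup>2 / 4" for x
    by (simp add: batch_energy_def algebra_simps)
  have int: "integrable D (\<lambda>x. batch_energy c w (s + (sgrad f w x - gradF w)))"
    unfolding eq using I(1) by simp
  have "(\<integral>x. batch_energy c w (s + (sgrad f w x - gradF w)) \<partial>D)
      = batch_energy c w s + 5 / 4 * noise_var w"
    unfolding eq using I by (simp add: batch_energy_def noise_var_def add_divide_distrib)
  then show ?thesis
    by (subst nn_integral_eq_integral[OF int]) (auto simp: batch_energy_nonneg)
qed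

lemma energy_batch_mean:
  assumes "0 < b"
  shows "energy w ((1 / real b) *\<^sub>R (\<Sum>i=1..b. y i))
    = batch_energy (real b) w (\<Sum>i=1..b. y i - gradF w) / (real b)\<^sup>2"
proof -
  define s where "s = (\<Sum>i=1..b. y i - gradF w)"
  have s: "(\<Sum>i=1..b. y i) = s + real b *\<^sub>R gradF w"
    by (simp add: s_def sum_subtractf scaleR_conv_of_real sum_constant_scaleR)
  have "(1 / real b) *\<^sub>R (s + real b *\<^sub>R gradF w) - gradF w = (1 / real b) *\<^sub>R s"
    using assms by (simp add: algebra_simps)
  moreover have "(norm ((1 / real b) *\<^sub>R z))\<^sup>2 = (norm z)\<^sup>2 / (real b)\<^sup>2" for z :: 'd
    by (simp add: power_divide)
  ultimately show ?thesis
    unfolding energy_def batch_energy_def s s_def[symmetric]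
    by (simp add: add_divide_distrib mult.commute)
qed

end

section \<open>Independent sources of randomness\<close>

text \<open>Disjoint groups of independent sources generate independent sigma-algebras, so the joint
  law of \<open>X\<close> and \<open>Y\<close> is the product of the marginals and Tonelli applies.
  The sources enter through set systems because their value types differ.\<close>

lemma (in prob_space) nn_integral_indep_collect:
  fixes E :: "'i \<Rightarrow> 'a set set"
  assumes indep: "indep_sets E I" and stable: "\<And>i. i \<in> I \<Longrightarrow> Int_stable (E i)"
    and JK: "J \<subseteq> I" "K \<subseteq> I" "J \<inter> K = {}"
    and X: "X \<in> measurable (sigma (space M) (\<Union>i\<in>J. E i)) S"
    and Y: "Y \<in> measurable (sigma (space M) (\<Union>i\<in>K. E i)) T"
    and h: "h \<in> borel_measurable (S \<Otimes>\<^sub>M T)"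
  shows "(\<integral>\<^sup>+\<omega>. h (X \<omega>, Y \<omega>) \<partial>M) = (\<integral>\<^sup>+\<omega>. (\<integral>\<^sup>+y. h (X \<omega>, y) \<partial>distr M T Y) \<partial>M)"
proof -
  let ?G = "\<lambda>J. \<Union>i\<in>J. E i"
  have E: "E i \<subseteq> events" if "i \<in> I" for i
    using indep that by (simp add: indep_sets_def)
  have G: "?G J' \<subseteq> events" if "J' \<subseteq> I" for J'
    using that E by blast
  have sets_G: "sets (sigma (space M) (?G J')) = sigma_sets (space M) (?G J')" if "J' \<subseteq> I" for J'
    using G[OF that] sets.space_closed[of M] by (intro sets_measure_of) blast
  have le: "sets (sigma (space M) (?G J')) \<subseteq> events" if "J' \<subseteq> I" for J'
    unfolding sets_G[OF that] using G[OF that] by (rule sets.sigma_sets_subset)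
  have sub: "measurable (sigma (space M) (?G J')) N \<subseteq> measurable M N" if "J' \<subseteq> I" for J' N
    using le[OF that] by (auto simp: measurable_def space_measure_of_conv)
  have XM: "X \<in> measurable M S" and YM: "Y \<in> measurable M T"
    using X Y sub JK by blast+
  have vimage: "Z -` A \<inter> space M \<in> sigma_sets (space M) (?G J')"
    if "Z \<in> measurable (sigma (space M) (?G J')) N" "J' \<subseteq> I" "A \<in> sets N" for Z J' N A
    using measurable_sets[OF that(1,3)] by (simp add: sets_G[OF that(2)] space_measure_of_conv)
  \<comment> \<open>The two groups are indexed by a boolean, in the form that
    \<open>indep_set\<close> expects.\<close>
  have "indep_sets (\<lambda>j. sigma_sets (space M) (\<Union>i\<in>(if j then J else K). E i)) UNIV"
    using JK stable
    by (intro indep_sets_collect_sigma indep_sets_mono_index[OF _ indep])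
       (auto simp: disjoint_family_on_def split: if_splits)
  then have ind: "indep_set (sigma_sets (space M) (?G J)) (sigma_sets (space M) (?G K))"
    unfolding indep_set_def by (rule indep_sets_mono_sets) (auto split: bool.split)
  interpret X: prob_space "distr M S X" by (rule prob_space_distr[OF XM])
  interpret Y: prob_space "distr M T Y" by (rule prob_space_distr[OF YM])
  have eq: "distr M S X \<Otimes>\<^sub>M distr M T Y = distr M (S \<Otimes>\<^sub>M T) (\<lambda>\<omega>. (X \<omega>, Y \<omega>))"
  proof (rule pair_measure_eqI)
    fix A B assume "A \<in> sets (distr M S X)" "B \<in> sets (distr M T Y)"
    then have A: "A \<in> sets S" and B: "B \<in> sets T" by auto
    have "(\<lambda>\<omega>. (X \<omega>, Y \<omega>)) -` (A \<times> B) \<inter> space M = (X -` A \<inter> space M) \<inter> (Y -` B \<inter> space M)"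
      by auto
    then have "emeasure (distr M (S \<Otimes>\<^sub>M T) (\<lambda>\<omega>. (X \<omega>, Y \<omega>))) (A \<times> B)
        = ennreal (prob ((X -` A \<inter> space M) \<inter> (Y -` B \<inter> space M)))"
      using XM YM A B by (simp add: emeasure_distr emeasure_eq_measure)
    also have "\<dots> = ennreal (prob (X -` A \<inter> space M) * prob (Y -` B \<inter> space M))"
      by (simp add: indep_setD[OF ind vimage[OF X JK(1) A] vimage[OF Y JK(2) B]])
    finally show "emeasure (distr M S X) A * emeasure (distr M T Y) B
        = emeasure (distr M (S \<Otimes>\<^sub>M T) (\<lambda>\<omega>. (X \<omega>, Y \<omega>))) (A \<times> B)"
      using XM YM A B by (simp add: emeasure_distr emeasure_eq_measure ennreal_mult)
  qed (simp_all add: X.sigma_finite_measure_axioms Y.sigma_finite_measure_axioms cong: sets_pair_measure_cong)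
  have h': "h \<in> borel_measurable (S \<Otimes>\<^sub>M distr M T Y)"
    using h by (simp cong: measurable_cong_sets)
  have "(\<integral>\<^sup>+\<omega>. h (X \<omega>, Y \<omega>) \<partial>M) = integral\<^sup>N (distr M (S \<Otimes>\<^sub>M T) (\<lambda>\<omega>. (X \<omega>, Y \<omega>))) h"
    using XM YM h by (simp add: nn_integral_distr)
  also have "\<dots> = (\<integral>\<^sup>+x. (\<integral>\<^sup>+y. h (x, y) \<partial>distr M T Y) \<partial>distr M S X)"
    unfolding eq[symmetric] using h by (intro Y.nn_integral_fst[symmetric]) (simp cong: measurable_cong_sets)
  also have "\<dots> = (\<integral>\<^sup>+\<omega>. (\<integral>\<^sup>+y. h (X \<omega>, y) \<partial>distr M T Y) \<partial>M)"
    using Y.borel_measurable_nn_integral_fst[OF h'] by (intro nn_integral_distr XM) simp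
  finally show ?thesis .
qed

section \<open>Information carried by the sources\<close>

primrec call :: "source \<Rightarrow> nat" where
  "call (Batch s i) = s"
| "call (Inner s t) = s"
| "call (Output s) = s"

context isarah_randomness
begin

definition source_events :: "source \<Rightarrow> 'w set set" where
  "source_events j = (case j of
      Batch s i \<Rightarrow> {\<zeta> s i -` A \<inter> space P | A. A \<in> sets D}
    | Inner s t \<Rightarrow> {\<xi> s t -` A \<inter> space P | A. A \<in> sets D}
    | Output s \<Rightarrow> {\<tau> s -` A \<inter> space P | A. A \<in> sets (count_space UNIV)})"

text \<open>Measurability with respect to \<open>sig J\<close> expresses that a quantity depends on
  the sources in \<open>J\<close> alone.\<close>

definition sig :: "source set \<Rightarrow> 'w measure" where
  "sig J = sigma (space P) (\<Union>j\<in>J. source_events j)"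

text \<open>Closure under intersection lets independence pass from these generators to the
  sigma-algebras generated by groups of sources.\<close>

lemma source_events_Int_stable: "Int_stable (source_events j)"
proof -
  have *: "Int_stable {Z -` A \<inter> space P | A. A \<in> sets N}" for Z :: "'w \<Rightarrow> 'z" and N
  proof (rule Int_stableI)
    fix a c assume "a \<in> {Z -` A \<inter> space P |A. A \<in> sets N}" "c \<in> {Z -` A \<inter> space P |A. A \<in> sets N}"
    then obtain A C where "a = Z -` A \<inter> space P" "A \<in> sets N" "c = Z -` C \<inter> space P" "C \<in> sets N"
      by auto
    then have "a \<inter> c = Z -` (A \<inter> C) \<inter> space P" "A \<inter> C \<in> sets N"
      by auto
    then show "a \<inter> c \<in> {Z -` A \<inter> space P |A. A \<in> sets N}" by blast
  qed
  show ?thesis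
    unfolding source_events_def by (cases j) (simp_all only: source.case *)
qed

lemma source_events_subset: "source_events j \<subseteq> Pow (space P)"
  by (cases j) (auto simp: source_events_def)

lemma space_sig [simp]: "space (sig J) = space P"
  by (simp add: sig_def space_measure_of_conv)

lemma sets_sig: "sets (sig J) = sigma_sets (space P) (\<Union>j\<in>J. source_events j)"
  unfolding sig_def using source_events_subset by (intro sets_measure_of) blast

lemma measurable_sig_mono:
  assumes "J \<subseteq> K" "X \<in> measurable (sig J) S"
  shows "X \<in> measurable (sig K) S"
proof -
  have "sets (sig J) \<subseteq> sets (sig K)"
    unfolding sets_sig using assms(1) by (intro sigma_sets_mono') blast
  with assms(2) show ?thesis
    by (auto simp: measurable_def)
qed

lemma measurable_sig_P:
  assumes "J \<subseteq> sources b T" "X \<in> measurable (sig J) S"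
  shows "X \<in> measurable P S"
proof -
  have "(\<Union>j\<in>J. source_events j) \<subseteq> events"
    using assms(1) independent unfolding indep_sets_def source_events_def by blast
  then have "sets (sig J) \<subseteq> events"
    unfolding sets_sig by (rule sets.sigma_sets_subset)
  with assms(2) show ?thesis
    by (auto simp: measurable_def)
qed

lemma source_events_in_sig: "j \<in> J \<Longrightarrow> A \<in> source_events j \<Longrightarrow> A \<in> sets (sig J)"
  unfolding sets_sig by (rule sigma_sets.Basic) blast

lemma measurable_sig_batch:
  assumes "s \<in> {1..T}" "i \<in> {1..b}" "Batch s i \<in> J"
  shows "\<zeta> s i \<in> measurable (sig J) D"
  using measurable_space[OF batch_measurable[OF assms(1,2)]] assms(3)
  by (intro measurableI source_events_in_sig[of "Batch s i"]) (auto simp: source_events_def)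

lemma measurable_sig_inner:
  assumes "s \<in> {1..T}" "1 \<le> t" "Inner s t \<in> J"
  shows "\<xi> s t \<in> measurable (sig J) D"
  using measurable_space[OF inner_measurable[OF assms(1,2)]] assms(3)
  by (intro measurableI source_events_in_sig[of "Inner s t"]) (auto simp: source_events_def)

lemma measurable_sig_output:
  assumes "Output s \<in> J"
  shows "\<tau> s \<in> measurable (sig J) (count_space UNIV)"
  using assms
  by (intro measurableI source_events_in_sig[of "Output s"]) (auto simp: source_events_def)

text \<open>Serves as conditioning on \<open>sig J\<close>: a fresh variable \<open>Y\<close> is
  integrated out first, with \<open>X\<close> held fixed.\<close>

lemma nn_integral_sig:
  assumes "J \<subseteq> sources b T" "K \<subseteq> sources b T" "J \<inter> K = {}"
    and "X \<in> measurable (sig J) S" "Y \<in> measurable (sig K) R" "h \<in> borel_measurable (S \<Otimes>\<^sub>M R)"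
  shows "(\<integral>\<^sup>+\<omega>. h (X \<omega>, Y \<omega>) \<partial>P) = (\<integral>\<^sup>+\<omega>. (\<integral>\<^sup>+y. h (X \<omega>, y) \<partial>distr P R Y) \<partial>P)"
  using independent source_events_Int_stable assms
  unfolding sig_def source_events_def[symmetric] by (rule nn_integral_indep_collect)

text \<open>The sources that determine outer iterate \<open>k\<close>, together with the first \<open>i\<close> batch samples of the
  call \<open>Suc k\<close> that starts from it, together with the whole batch and the first \<open>t\<close> inner samples.\<close>

definition past :: "nat \<Rightarrow> source set" where
  "past k = {j \<in> sources b T. call j \<le> k}"

definition batch_past :: "nat \<Rightarrow> nat \<Rightarrow> source set" where
  "batch_past k i = past k \<union> Batch (Suc k) ` {1..i}"

definition inner_past :: "nat \<Rightarrow> nat \<Rightarrow> source set" where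
  "inner_past k t = batch_past k b \<union> Inner (Suc k) ` {1..t}"

lemma past_subset: "past k \<subseteq> sources b T"
  by (auto simp: past_def)

lemma batch_past_subset: "k < T \<Longrightarrow> i \<le> b \<Longrightarrow> batch_past k i \<subseteq> sources b T"
  using past_subset by (auto simp: batch_past_def sources_def)

lemma inner_past_subset: "k < T \<Longrightarrow> inner_past k t \<subseteq> sources b T"
  using batch_past_subset[of k b] by (auto simp: inner_past_def sources_def)

lemma inner_past_subset_past: "k < T \<Longrightarrow> insert (Output (Suc k)) (inner_past k t) \<subseteq> past (Suc k)"
  by (auto simp: inner_past_def batch_past_def past_def sources_def)

text \<open>Each draw is absent from the sources that determine the quantities it acts upon; this is
  the disjointness that \<open>nn_integral_sig\<close> asks for.\<close>

lemma fresh_sources: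
  "Batch (Suc k) (Suc i) \<notin> batch_past k i"
  "Inner (Suc k) (Suc t) \<notin> inner_past k t"
  "Output (Suc k) \<notin> inner_past k t"
  by (auto simp: inner_past_def batch_past_def past_def)

end

section \<open>Expected gradients along a run\<close>

text \<open>\<open>batch_pos\<close> makes the division by \<open>b\<close> meaningful; the
  prescribed batch size satisfies it because \<open>60 * \<sigma>\<^sup>2 / \<epsilon>\<close> is
  positive.\<close>

locale isarah_run = smooth_convex_objective D f L \<sigma> wstar + P: isarah_randomness P D m b T \<zeta> \<xi> \<tau>
  for D :: "'x measure" and f :: "'d::euclidean_space \<Rightarrow> 'x \<Rightarrow> real" and L \<sigma> :: real
    and wstar :: 'd and P :: "'w measure" and m b T :: nat
    and \<zeta> \<xi> :: "nat \<Rightarrow> nat \<Rightarrow> 'w \<Rightarrow> 'x" and \<tau> :: "nat \<Rightarrow> 'w \<Rightarrow> nat" +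
  fixes w0 :: 'd
  assumes batch_pos: "0 < b"
begin

abbreviation iterate :: "nat \<Rightarrow> 'w \<Rightarrow> 'd" where
  "iterate \<equiv> isarah_iterate f (2 / (5 * L)) b \<zeta> \<xi> \<tau> w0"

text \<open>The call that starts from \<open>iterate k\<close> has number \<open>Suc k\<close>,
  hence the shifted sample indices.\<close>

definition state :: "nat \<Rightarrow> nat \<Rightarrow> 'w \<Rightarrow> 'd \<times> 'd" where
  "state k t \<omega> = isarah_state f (2 / (5 * L)) b (\<lambda>i. \<zeta> (Suc k) i \<omega>) (\<lambda>t. \<xi> (Suc k) t \<omega>)
    (iterate k \<omega>) t"

text \<open>Left unnormalized so that each further sample adds one centered summand.\<close>

definition batch_error :: "nat \<Rightarrow> nat \<Rightarrow> 'w \<Rightarrow> 'd" where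
  "batch_error k i \<omega> = (\<Sum>j=1..i. sgrad f (iterate k \<omega>) (\<zeta> (Suc k) j \<omega>) - gradF (iterate k \<omega>))"

lemma iterate_0: "iterate 0 = (\<lambda>\<omega>. w0)"
  by (simp add: isarah_iterate_def fun_eq_iff)

lemma iterate_Suc: "iterate (Suc k) = (\<lambda>\<omega>. fst (state k (\<tau> (Suc k) \<omega>) \<omega>))"
  by (simp add: isarah_iterate_def isarah_in_def state_def fun_eq_iff)

lemma state_0:
  "state k 0 = (\<lambda>\<omega>. (iterate k \<omega>,
    (1 / real b) *\<^sub>R (\<Sum>i=1..b. sgrad f (iterate k \<omega>) (\<zeta> (Suc k) i \<omega>))))"
  by (simp add: state_def fun_eq_iff)

lemma state_Suc:
  "state k (Suc t) = (\<lambda>\<omega>. let (w, v) = state k t \<omega>; w' = w - (2 / (5 * L)) *\<^sub>R v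
     in (w', sgrad f w' (\<xi> (Suc k) (Suc t) \<omega>) - sgrad f w (\<xi> (Suc k) (Suc t) \<omega>) + v))"
  by (simp add: state_def fun_eq_iff)

section \<open>Measurability of the run\<close>

text \<open>Measurability of \<open>iterate k\<close> is a hypothesis because this lemma is applied
  inside the induction that establishes it.\<close>

lemma measurable_state:
  assumes k: "k < T" and W: "iterate k \<in> borel_measurable (P.sig (P.past k))"
  shows "state k t \<in> measurable (P.sig (P.inner_past k t)) (borel \<Otimes>\<^sub>M borel)"
proof (induction t)
  case 0
  have W0: "iterate k \<in> borel_measurable (P.sig (P.inner_past k 0))"
    by (rule P.measurable_sig_mono[OF _ W]) (auto simp: P.inner_past_def P.batch_past_def)
  have "(\<lambda>\<omega>. sgrad f (iterate k \<omega>) (\<zeta> (Suc k) i \<omega>)) \<in> borel_measurable (P.sig (P.inner_past k 0))"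
    if "i \<in> {1..b}" for i
    using k that
    by (intro measurable_sgrad_compose W0 P.measurable_sig_batch)
      (auto simp: P.inner_past_def P.batch_past_def)
  with W0 show ?case
    unfolding state_0 by (intro measurable_Pair borel_measurable_scaleR borel_measurable_sum) auto
next
  case (Suc t)
  have [measurable]: "state k t \<in> measurable (P.sig (P.inner_past k (Suc t))) (borel \<Otimes>\<^sub>M borel)"
    by (rule P.measurable_sig_mono[OF _ Suc]) (auto simp: P.inner_past_def)
  have [measurable]: "\<xi> (Suc k) (Suc t) \<in> measurable (P.sig (P.inner_past k (Suc t))) D"
    using k by (intro P.measurable_sig_inner) (auto simp: P.inner_past_def)
  show ?case
    unfolding state_Suc Let_def case_prod_unfold by measurable
qed

lemma measurable_iterate:
  "k \<le> T \<Longrightarrow> iterate k \<in> borel_measurable (P.sig (P.past k))"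
proof (induction k)
  case 0
  show ?case by (simp add: iterate_0)
next
  case (Suc k)
  then have k: "k < T" and W: "iterate k \<in> borel_measurable (P.sig (P.past k))" by auto
  note sub = P.inner_past_subset_past[OF k]
  show ?case
    unfolding iterate_Suc
  \<comment> \<open>The output index is random, so the claim is checked for each of its countably
    many values.\<close>
  proof (rule measurable_compose_countable)
    show "\<tau> (Suc k) \<in> measurable (P.sig (P.past (Suc k))) (count_space UNIV)"
      using sub by (intro P.measurable_sig_output) blast
    show "(\<lambda>\<omega>. fst (state k t \<omega>)) \<in> borel_measurable (P.sig (P.past (Suc k)))" for t
      using sub by (intro measurable_compose[OF P.measurable_sig_mono[OF _ measurable_state[OF k W]] measurable_fst])
        blast
  qed
qed

lemma measurable_iterate_P: "k \<le> T \<Longrightarrow> iterate k \<in> borel_measurable P"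
  by (rule P.measurable_sig_P[OF P.past_subset measurable_iterate])

lemma measurable_state_sig:
  "k < T \<Longrightarrow> state k t \<in> measurable (P.sig (P.inner_past k t)) (borel \<Otimes>\<^sub>M borel)"
  by (intro measurable_state measurable_iterate) auto

lemma measurable_state_P: "k < T \<Longrightarrow> state k t \<in> measurable P (borel \<Otimes>\<^sub>M borel)"
  by (rule P.measurable_sig_P[OF P.inner_past_subset measurable_state_sig])

lemma measurable_batch_error:
  assumes k: "k < T" and i: "i \<le> b"
  shows "(\<lambda>\<omega>. (iterate k \<omega>, batch_error k i \<omega>))
    \<in> measurable (P.sig (P.batch_past k i)) (borel \<Otimes>\<^sub>M borel)"
proof -
  have W [measurable]: "iterate k \<in> borel_measurable (P.sig (P.batch_past k i))"
    using k by (intro P.measurable_sig_mono[OF _ measurable_iterate]) (auto simp: P.batch_past_def)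
  have "(\<lambda>\<omega>. sgrad f (iterate k \<omega>) (\<zeta> (Suc k) j \<omega>)) \<in> borel_measurable (P.sig (P.batch_past k i))"
    if "j \<in> {1..i}" for j
    using k i that by (intro measurable_sgrad_compose W P.measurable_sig_batch) (auto simp: P.batch_past_def)
  moreover have "(\<lambda>\<omega>. gradF (iterate k \<omega>)) \<in> borel_measurable (P.sig (P.batch_past k i))"
    by measurable
  ultimately show ?thesis
    unfolding batch_error_def
    by (intro measurable_Pair borel_measurable_sum borel_measurable_diff) auto
qed

section \<open>Expected initial energy of a call\<close>

text \<open>Samples are added one at a time: each is independent of the iterate and of the samples
  before it, so \<open>batch_energy_step\<close> applies once it is integrated out. Nonnegative
  integrals keep the identity valid even if both sides are infinite.\<close>

lemma batch_error_energy:
  assumes k: "k < T"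
  shows "i \<le> b \<Longrightarrow> (\<integral>\<^sup>+\<omega>. ennreal (batch_energy c (iterate k \<omega>) (batch_error k i \<omega>)) \<partial>P)
    = (\<integral>\<^sup>+\<omega>. ennreal (batch_energy c (iterate k \<omega>) 0 + real i * (5 / 4 * noise_var (iterate k \<omega>))) \<partial>P)"
proof (induction i)
  case 0
  show ?case by (simp add: batch_error_def)
next
  case (Suc i)
  have W [measurable]: "iterate k \<in> borel_measurable P"
    using k by (intro measurable_iterate_P) simp
  have X: "(\<lambda>\<omega>. (iterate k \<omega>, batch_error k i \<omega>)) \<in> measurable (P.sig (P.batch_past k i)) (borel \<Otimes>\<^sub>M borel)"
    using k Suc.prems by (intro measurable_batch_error) auto
  have sub: "P.batch_past k i \<subseteq> sources b T"
    using k Suc.prems by (intro P.batch_past_subset) auto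
  have S [measurable]: "batch_error k i \<in> borel_measurable P"
    using measurable_compose[OF P.measurable_sig_P[OF sub X] measurable_snd] by simp
  let ?h = "\<lambda>p. ennreal (batch_energy c (fst (fst p))
    (snd (fst p) + (sgrad f (fst (fst p)) (snd p) - gradF (fst (fst p)))))"
  have "(\<integral>\<^sup>+\<omega>. ennreal (batch_energy c (iterate k \<omega>) (batch_error k (Suc i) \<omega>)) \<partial>P)
      = (\<integral>\<^sup>+\<omega>. ?h ((iterate k \<omega>, batch_error k i \<omega>), \<zeta> (Suc k) (Suc i) \<omega>) \<partial>P)"
    by (simp add: batch_error_def)
  also have "\<dots> = (\<integral>\<^sup>+\<omega>. (\<integral>\<^sup>+x. ?h ((iterate k \<omega>, batch_error k i \<omega>), x)
      \<partial>distr P D (\<zeta> (Suc k) (Suc i))) \<partial>P)"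
  proof (rule P.nn_integral_sig[OF sub _ _ X])
    show "{Batch (Suc k) (Suc i)} \<subseteq> sources b T"
      using k Suc.prems by (auto simp: sources_def)
    show "P.batch_past k i \<inter> {Batch (Suc k) (Suc i)} = {}"
      using P.fresh_sources(1) by blast
    show "\<zeta> (Suc k) (Suc i) \<in> measurable (P.sig {Batch (Suc k) (Suc i)}) D"
      using k Suc.prems by (intro P.measurable_sig_batch) auto
  qed measurable
  also have "distr P D (\<zeta> (Suc k) (Suc i)) = D"
    using k Suc.prems by (intro P.batch_distr) auto
  also have "(\<integral>\<^sup>+\<omega>. (\<integral>\<^sup>+x. ?h ((iterate k \<omega>, batch_error k i \<omega>), x) \<partial>D) \<partial>P)
      = (\<integral>\<^sup>+\<omega>. ennreal (batch_energy c (iterate k \<omega>) (batch_error k i \<omega>)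
          + 5 / 4 * noise_var (iterate k \<omega>)) \<partial>P)"
    by (simp add: batch_energy_step)
  also have "\<dots> = (\<integral>\<^sup>+\<omega>. ennreal (batch_energy c (iterate k \<omega>) (batch_error k i \<omega>)) \<partial>P)
      + (\<integral>\<^sup>+\<omega>. ennreal (5 / 4 * noise_var (iterate k \<omega>)) \<partial>P)"
    by (subst nn_integral_add[symmetric])
      (auto simp: batch_energy_nonneg noise_var_nonneg ennreal_plus intro!: nn_integral_cong)
  also have "\<dots> = (\<integral>\<^sup>+\<omega>. ennreal (batch_energy c (iterate k \<omega>) 0
        + real i * (5 / 4 * noise_var (iterate k \<omega>))) \<partial>P)
      + (\<integral>\<^sup>+\<omega>. ennreal (5 / 4 * noise_var (iterate k \<omega>)) \<partial>P)"
    using Suc by simp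
  also have "\<dots> = (\<integral>\<^sup>+\<omega>. ennreal (batch_energy c (iterate k \<omega>) 0
        + real (Suc i) * (5 / 4 * noise_var (iterate k \<omega>))) \<partial>P)"
  proof (subst nn_integral_add[symmetric])
    have eq: "ennreal (a + real i * c') + ennreal c' = ennreal (a + real (Suc i) * c')"
      if "0 \<le> a" "0 \<le> c'" for a c'
      using that by (simp add: ennreal_plus[symmetric] algebra_simps del: ennreal_plus)
    show "(\<integral>\<^sup>+\<omega>. ennreal (batch_energy c (iterate k \<omega>) 0 + real i * (5 / 4 * noise_var (iterate k \<omega>)))
          + ennreal (5 / 4 * noise_var (iterate k \<omega>)) \<partial>P)
        = (\<integral>\<^sup>+\<omega>. ennreal (batch_energy c (iterate k \<omega>) 0
          + real (Suc i) * (5 / 4 * noise_var (iterate k \<omega>))) \<partial>P)"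
      by (intro nn_integral_cong eq) (simp_all add: batch_energy_nonneg noise_var_nonneg)
  qed measurable
  finally show ?case .
qed

text \<open>The preceding identity with \<open>i\<close> and \<open>c\<close> both equal to
  \<open>b\<close>, divided by \<open>b\<^sup>2\<close>: the variance is collected \<open>b\<close>
  times and ends up with a factor \<open>1 / b\<close>.\<close>

lemma initial_energy:
  assumes k: "k < T"
  shows "(\<integral>\<^sup>+\<omega>. ennreal (energy (fst (state k 0 \<omega>)) (snd (state k 0 \<omega>))) \<partial>P)
    = (\<integral>\<^sup>+\<omega>. ennreal ((norm (gradF (iterate k \<omega>)))\<^sup>2 / 4
        + 5 / (4 * real b) * noise_var (iterate k \<omega>)) \<partial>P)"
proof -
  have [measurable]: "iterate k \<in> borel_measurable P"
    using k by (intro measurable_iterate_P) simp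
  have [measurable]: "batch_error k b \<in> borel_measurable P"
    using measurable_compose[OF P.measurable_sig_P[OF P.batch_past_subset measurable_batch_error]
        measurable_snd, of k b] k by simp
  have "(\<integral>\<^sup>+\<omega>. ennreal (energy (fst (state k 0 \<omega>)) (snd (state k 0 \<omega>))) \<partial>P)
      = (\<integral>\<^sup>+\<omega>. ennreal (1 / (real b)\<^sup>2) *
          ennreal (batch_energy (real b) (iterate k \<omega>) (batch_error k b \<omega>)) \<partial>P)"
    unfolding state_0 fst_conv snd_conv energy_batch_mean[OF batch_pos] batch_error_def[symmetric]
    by (simp add: ennreal_mult[symmetric] batch_energy_nonneg)
  also have "\<dots> = ennreal (1 / (real b)\<^sup>2) * (\<integral>\<^sup>+\<omega>. ennreal (batch_energy (real b) (iterate k \<omega>) 0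
      + real b * (5 / 4 * noise_var (iterate k \<omega>))) \<partial>P)"
    by (simp add: nn_integral_cmult batch_error_energy[OF k])
  also have "\<dots> = (\<integral>\<^sup>+\<omega>. ennreal (1 / (real b)\<^sup>2) * ennreal (batch_energy (real b) (iterate k \<omega>) 0
      + real b * (5 / 4 * noise_var (iterate k \<omega>))) \<partial>P)"
    by (simp add: nn_integral_cmult)
  also have "\<dots> = (\<integral>\<^sup>+\<omega>. ennreal ((norm (gradF (iterate k \<omega>)))\<^sup>2 / 4
        + 5 / (4 * real b) * noise_var (iterate k \<omega>)) \<partial>P)"
  proof (rule nn_integral_cong)
    fix \<omega>
    have eq: "1 / (real b)\<^sup>2 * (batch_energy (real b) (iterate k \<omega>) 0
        + real b * (5 / 4 * noise_var (iterate k \<omega>)))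
      = (norm (gradF (iterate k \<omega>)))\<^sup>2 / 4 + 5 / (4 * real b) * noise_var (iterate k \<omega>)"
      using batch_pos by (simp add: batch_energy_def power_mult_distrib field_simps power2_eq_square)
    show "ennreal (1 / (real b)\<^sup>2) * ennreal (batch_energy (real b) (iterate k \<omega>) 0
        + real b * (5 / 4 * noise_var (iterate k \<omega>)))
      = ennreal ((norm (gradF (iterate k \<omega>)))\<^sup>2 / 4 + 5 / (4 * real b) * noise_var (iterate k \<omega>))"
      unfolding eq[symmetric]
      by (rule ennreal_mult[symmetric]) (simp_all add: batch_energy_nonneg noise_var_nonneg)
  qed
  finally show ?thesis .
qed

section \<open>Gradients along the inner loop and at the output\<close>

text \<open>The sample of step \<open>Suc t\<close> is independent of \<open>state k t\<close>;
  integrating it out reduces the claim to \<open>energy_step\<close> for a fixed state.\<close>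

lemma expected_energy_antimono:
  assumes k: "k < T"
  shows "(\<integral>\<^sup>+\<omega>. ennreal (energy (fst (state k (Suc t) \<omega>)) (snd (state k (Suc t) \<omega>))) \<partial>P)
    \<le> (\<integral>\<^sup>+\<omega>. ennreal (energy (fst (state k t \<omega>)) (snd (state k t \<omega>))) \<partial>P)"
proof -
  let ?step = "\<lambda>w v. w - (2 / (5 * L)) *\<^sub>R v"
  let ?h = "\<lambda>p. case p of ((w, v), x) \<Rightarrow>
    ennreal (energy (?step w v) (sgrad f (?step w v) x - sgrad f w x + v))"
  have h: "?h \<in> borel_measurable ((borel \<Otimes>\<^sub>M borel) \<Otimes>\<^sub>M D)"
    unfolding energy_def case_prod_unfold by measurable
  have "(\<integral>\<^sup>+\<omega>. ennreal (energy (fst (state k (Suc t) \<omega>)) (snd (state k (Suc t) \<omega>))) \<partial>P)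
      = (\<integral>\<^sup>+\<omega>. ?h (state k t \<omega>, \<xi> (Suc k) (Suc t) \<omega>) \<partial>P)"
    by (simp add: state_Suc Let_def case_prod_unfold)
  also have "\<dots> = (\<integral>\<^sup>+\<omega>. (\<integral>\<^sup>+x. ?h (state k t \<omega>, x) \<partial>distr P D (\<xi> (Suc k) (Suc t))) \<partial>P)"
  proof (rule P.nn_integral_sig[OF P.inner_past_subset[OF k] _ _ measurable_state_sig[OF k] _ h])
    show "{Inner (Suc k) (Suc t)} \<subseteq> sources b T"
      using k by (auto simp: sources_def)
    show "P.inner_past k t \<inter> {Inner (Suc k) (Suc t)} = {}"
      using P.fresh_sources(2) by blast
    show "\<xi> (Suc k) (Suc t) \<in> measurable (P.sig {Inner (Suc k) (Suc t)}) D"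
      using k by (intro P.measurable_sig_inner) auto
  qed
  also have "distr P D (\<xi> (Suc k) (Suc t)) = D"
    using k by (intro P.inner_distr) auto
  also have "(\<integral>\<^sup>+\<omega>. (\<integral>\<^sup>+x. ?h (state k t \<omega>, x) \<partial>D) \<partial>P)
      \<le> (\<integral>\<^sup>+\<omega>. ennreal (energy (fst (state k t \<omega>)) (snd (state k t \<omega>))) \<partial>P)"
    by (intro nn_integral_mono) (simp add: case_prod_unfold energy_step)
  finally show ?thesis .
qed

lemma expected_energy_le:
  assumes k: "k < T"
  shows "(\<integral>\<^sup>+\<omega>. ennreal (energy (fst (state k t \<omega>)) (snd (state k t \<omega>))) \<partial>P)
    \<le> (\<integral>\<^sup>+\<omega>. ennreal (energy (fst (state k 0 \<omega>)) (snd (state k 0 \<omega>))) \<partial>P)"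
  by (induction t) (auto intro: order_trans[OF expected_energy_antimono[OF k]])

text \<open>Summation of \<open>gap_step\<close> over the inner loop, with each expected energy
  bounded by the initial one. The last gap stays on the left, so the sum telescopes without
  subtraction in \<open>ennreal\<close>.\<close>

lemma sum_expected_gradient:
  assumes k: "k < T"
  shows "(\<Sum>t<n. \<integral>\<^sup>+\<omega>. ennreal ((norm (gradF (fst (state k t \<omega>))))\<^sup>2) \<partial>P)
      + (\<integral>\<^sup>+\<omega>. ennreal (5 * L * gap (fst (state k n \<omega>))) \<partial>P)
    \<le> (\<integral>\<^sup>+\<omega>. ennreal (5 * L * gap (iterate k \<omega>)) \<partial>P)
      + of_nat n * (\<integral>\<^sup>+\<omega>. ennreal (energy (fst (state k 0 \<omega>)) (snd (state k 0 \<omega>))) \<partial>P)"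
proof -
  let ?G = "\<lambda>n. \<Sum>t<n. \<integral>\<^sup>+\<omega>. ennreal ((norm (gradF (fst (state k t \<omega>))))\<^sup>2) \<partial>P"
  let ?d = "\<lambda>n. \<integral>\<^sup>+\<omega>. ennreal (5 * L * gap (fst (state k n \<omega>))) \<partial>P"
  let ?c = "\<integral>\<^sup>+\<omega>. ennreal (5 * L * gap (iterate k \<omega>)) \<partial>P"
  let ?e = "\<lambda>n. \<integral>\<^sup>+\<omega>. ennreal (energy (fst (state k n \<omega>)) (snd (state k n \<omega>))) \<partial>P"
  show "?G n + ?d n \<le> ?c + of_nat n * ?e 0"
proof (induction n)
  case 0
  show ?case by (simp add: state_0)
next
  case (Suc n)
  have [measurable]: "state k t \<in> measurable P (borel \<Otimes>\<^sub>M borel)" for t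
    by (rule measurable_state_P[OF k])
  have L: "0 \<le> L" using L_pos by simp
  have "(\<integral>\<^sup>+\<omega>. ennreal ((norm (gradF (fst (state k n \<omega>))))\<^sup>2) \<partial>P) + ?d (Suc n)
      = (\<integral>\<^sup>+\<omega>. ennreal ((norm (gradF (fst (state k n \<omega>))))\<^sup>2 + 5 * L * gap (fst (state k (Suc n) \<omega>))) \<partial>P)"
    using L by (subst nn_integral_add[symmetric]) (auto simp: gap_nonneg ennreal_plus intro!: nn_integral_cong)
  also have "\<dots> \<le> (\<integral>\<^sup>+\<omega>. ennreal (5 * L * gap (fst (state k n \<omega>))
      + energy (fst (state k n \<omega>)) (snd (state k n \<omega>))) \<partial>P)"
    by (intro nn_integral_mono ennreal_leI) (simp add: state_Suc Let_def case_prod_unfold gap_step)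
  also have "\<dots> = ?d n + ?e n"
    using L by (subst nn_integral_add[symmetric])
      (auto simp: gap_nonneg energy_nonneg ennreal_plus intro!: nn_integral_cong)
  also have "\<dots> \<le> ?d n + ?e 0"
    by (intro add_mono expected_energy_le[OF k] order_refl)
  finally have "?G (Suc n) + ?d (Suc n) \<le> (?G n + ?d n) + ?e 0"
    by (simp add: add.assoc add_left_mono)
  also have "\<dots> \<le> (?c + of_nat n * ?e 0) + ?e 0"
    by (intro add_mono Suc order_refl)
  finally show ?case
    by (simp add: algebra_simps)
qed
qed

text \<open>The index \<open>\<tau> (Suc k)\<close> is independent of the path and takes each value
  up to \<open>m\<close> with probability \<open>1 / (m + 1)\<close>; splitting by indicators of its
  value gives the average over the path.\<close>

lemma expected_gradient_output:
  assumes k: "k < T"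
  shows "(\<integral>\<^sup>+\<omega>. ennreal ((norm (gradF (iterate (Suc k) \<omega>)))\<^sup>2) \<partial>P)
    = ennreal (1 / (real m + 1)) *
      (\<Sum>t<Suc m. \<integral>\<^sup>+\<omega>. ennreal ((norm (gradF (fst (state k t \<omega>))))\<^sup>2) \<partial>P)"
proof -
  have Sk: "Suc k \<in> {1..T}" using k by simp
  have [measurable]: "state k t \<in> measurable P (borel \<Otimes>\<^sub>M borel)" for t
    by (rule measurable_state_P[OF k])
  have [measurable]: "\<tau> (Suc k) \<in> measurable P (count_space UNIV)"
    by (rule P.output_measurable[OF Sk])
  have [measurable]: "(\<lambda>\<omega>. indicator {t} (\<tau> (Suc k) \<omega>) :: ennreal) \<in> borel_measurable P" for t
    by (rule measurable_compose[OF P.output_measurable[OF Sk]]) simp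
  let ?g = "\<lambda>t \<omega>. ennreal ((norm (gradF (fst (state k t \<omega>))))\<^sup>2)"
  \<comment> \<open>The index may exceed \<open>m\<close> on a null set, so the finite splitting
    holds almost everywhere only.\<close>
  have "AE j in distr P (count_space UNIV) (\<tau> (Suc k)). j \<le> m"
    unfolding P.output_distr[OF Sk] by (simp add: AE_measure_pmf_iff)
  then have "AE \<omega> in P. \<tau> (Suc k) \<omega> \<le> m"
    by (rule AE_distrD[rotated]) measurable
  then have "(\<integral>\<^sup>+\<omega>. ennreal ((norm (gradF (iterate (Suc k) \<omega>)))\<^sup>2) \<partial>P)
      = (\<integral>\<^sup>+\<omega>. (\<Sum>t<Suc m. ?g t \<omega> * indicator {t} (\<tau> (Suc k) \<omega>)) \<partial>P)"
  proof (intro nn_integral_cong_AE, eventually_elim)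
    case (elim \<omega>)
    then have "(\<Sum>t<Suc m. ?g t \<omega> * indicator {t} (\<tau> (Suc k) \<omega>)) = ?g (\<tau> (Suc k) \<omega>) \<omega>"
      by (subst sum.remove[of _ "\<tau> (Suc k) \<omega>"]) (auto intro!: sum.neutral)
    then show ?case by (simp add: iterate_Suc)
  qed
  also have "\<dots> = (\<Sum>t<Suc m. \<integral>\<^sup>+\<omega>. ?g t \<omega> * indicator {t} (\<tau> (Suc k) \<omega>) \<partial>P)"
    by (intro nn_integral_sum) measurable
  also have "\<dots> = (\<Sum>t<Suc m. ennreal (1 / (real m + 1)) * (\<integral>\<^sup>+\<omega>. ?g t \<omega> \<partial>P))"
  proof (rule sum.cong[OF refl])
    fix t assume t: "t \<in> {..<Suc m}"
    let ?h = "\<lambda>p :: ('d \<times> 'd) \<times> nat. ennreal ((norm (gradF (fst (fst p))))\<^sup>2) * indicator {t} (snd p)"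
    have [measurable]: "(\<lambda>p. indicator {t} (snd p) :: ennreal)
        \<in> borel_measurable ((borel \<Otimes>\<^sub>M borel) \<Otimes>\<^sub>M count_space UNIV)"
      by (rule measurable_compose[OF measurable_snd]) simp
    have "(\<integral>\<^sup>+\<omega>. ?h (state k t \<omega>, \<tau> (Suc k) \<omega>) \<partial>P)
        = (\<integral>\<^sup>+\<omega>. (\<integral>\<^sup>+j. ?h (state k t \<omega>, j) \<partial>distr P (count_space UNIV) (\<tau> (Suc k))) \<partial>P)"
    proof (rule P.nn_integral_sig[OF P.inner_past_subset[OF k] _ _ measurable_state_sig[OF k]])
      show "{Output (Suc k)} \<subseteq> sources b T"
        using k by (auto simp: sources_def)
      show "P.inner_past k t \<inter> {Output (Suc k)} = {}"
        using P.fresh_sources(3) by blast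
      show "\<tau> (Suc k) \<in> measurable (P.sig {Output (Suc k)}) (count_space UNIV)"
        by (intro P.measurable_sig_output) simp
    qed measurable
    also have "\<dots> = (\<integral>\<^sup>+\<omega>. ?g t \<omega> * ennreal (1 / (real m + 1)) \<partial>P)"
    proof -
      have "emeasure (measure_pmf (pmf_of_set {0..m})) {t} = ennreal (1 / (real m + 1))"
        using t by (simp add: emeasure_pmf_single pmf_of_set add.commute)
      then show ?thesis
        unfolding P.output_distr[OF Sk] by (simp add: nn_integral_cmult)
    qed
    also have "\<dots> = ennreal (1 / (real m + 1)) * (\<integral>\<^sup>+\<omega>. ?g t \<omega> \<partial>P)"
      by (subst mult.commute) (simp add: nn_integral_cmult)
    finally show "(\<integral>\<^sup>+\<omega>. ?g t \<omega> * indicator {t} (\<tau> (Suc k) \<omega>) \<partial>P)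
        = ennreal (1 / (real m + 1)) * (\<integral>\<^sup>+\<omega>. ?g t \<omega> \<partial>P)"
      by simp
  qed
  finally show ?thesis
    by (simp only: sum_distrib_left)
qed

text \<open>Averaging over the inner loop divides the initial gap by \<open>m + 1\<close>, whereas
  the initial energy, counted \<open>m + 1\<close> times in the sum, keeps its full weight.\<close>

lemma expected_gradient_step:
  assumes k: "k < T"
  shows "(\<integral>\<^sup>+\<omega>. ennreal ((norm (gradF (iterate (Suc k) \<omega>)))\<^sup>2) \<partial>P)
    \<le> (\<integral>\<^sup>+\<omega>. ennreal (5 * L / (real m + 1) * gap (iterate k \<omega>)
        + ((norm (gradF (iterate k \<omega>)))\<^sup>2 / 4 + 5 / (4 * real b) * noise_var (iterate k \<omega>))) \<partial>P)"
proof -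
  have [measurable]: "iterate k \<in> borel_measurable P"
    using k by (intro measurable_iterate_P) simp
  let ?e = "\<lambda>\<omega>. (norm (gradF (iterate k \<omega>)))\<^sup>2 / 4 + 5 / (4 * real b) * noise_var (iterate k \<omega>)"
  have e: "0 \<le> ?e \<omega>" for \<omega> by (simp add: noise_var_nonneg)
  \<comment> \<open>The indices 0 to \<open>m\<close> are \<open>m + 1\<close> many, hence
    \<open>Suc m\<close>; the final gap is dropped.\<close>
  have "(\<Sum>t<Suc m. \<integral>\<^sup>+\<omega>. ennreal ((norm (gradF (fst (state k t \<omega>))))\<^sup>2) \<partial>P)
      \<le> (\<integral>\<^sup>+\<omega>. ennreal (5 * L * gap (iterate k \<omega>)) \<partial>P) + of_nat (Suc m) * (\<integral>\<^sup>+\<omega>. ennreal (?e \<omega>) \<partial>P)"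
    using sum_expected_gradient[OF k, of "Suc m"] unfolding initial_energy[OF k]
    by (rule order_trans[rotated]) simp
  then have "(\<integral>\<^sup>+\<omega>. ennreal ((norm (gradF (iterate (Suc k) \<omega>)))\<^sup>2) \<partial>P)
      \<le> ennreal (1 / (real m + 1)) * ((\<integral>\<^sup>+\<omega>. ennreal (5 * L * gap (iterate k \<omega>)) \<partial>P)
        + of_nat (Suc m) * (\<integral>\<^sup>+\<omega>. ennreal (?e \<omega>) \<partial>P))"
    unfolding expected_gradient_output[OF k] by (rule mult_left_mono) simp
  also have "\<dots> = (\<integral>\<^sup>+\<omega>. ennreal (1 / (real m + 1)) * (ennreal (5 * L * gap (iterate k \<omega>))
        + of_nat (Suc m) * ennreal (?e \<omega>)) \<partial>P)"
    by (simp add: nn_integral_cmult nn_integral_add)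
  also have "\<dots> = (\<integral>\<^sup>+\<omega>. ennreal (5 * L / (real m + 1) * gap (iterate k \<omega>) + ?e \<omega>) \<partial>P)"
  proof (rule nn_integral_cong)
    fix \<omega>
    have "1 / (real m + 1) * (5 * L * gap (iterate k \<omega>) + real (Suc m) * ?e \<omega>)
        = 5 * L / (real m + 1) * gap (iterate k \<omega>) + ?e \<omega>"
    proof -
      have "1 / (real m + 1) * (a + real (Suc m) * c) = a / (real m + 1) + c" for a c
        by (simp add: field_simps)
      then show ?thesis by simp
    qed
    then show "ennreal (1 / (real m + 1)) * (ennreal (5 * L * gap (iterate k \<omega>))
        + of_nat (Suc m) * ennreal (?e \<omega>))
      = ennreal (5 * L / (real m + 1) * gap (iterate k \<omega>) + ?e \<omega>)"
      using L_pos e[of \<omega>] gap_nonneg[of "iterate k \<omega>"]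
      by (simp only: ennreal_of_nat_eq_real_of_nat ennreal_mult[symmetric] ennreal_plus[symmetric]
          of_nat_0_le_iff mult_nonneg_nonneg add_nonneg_nonneg zero_le_numeral less_imp_le
          divide_nonneg_nonneg zero_le_one)
  qed
  finally show ?thesis .
qed

end

section \<open>Numerical constants and the recursion over outer calls\<close>

text \<open>Here \<open>q\<close> stands for \<open>m + 1\<close>. The loop length makes the gap
  term at most \<open>g / 8 + \<epsilon> / 24\<close>, the batch size makes the variance term at
  most \<open>g / 8 + \<epsilon> / 12\<close>; together with \<open>g / 4\<close> this adds up to
  the right side.\<close>

lemma step_constants:
  fixes L M N \<sigma> \<epsilon> q b d g V :: real
  assumes pos: "0 < L" "0 < \<epsilon>" "0 < q" "0 < b" and g: "0 \<le> g"
    and q: "40 * L * M \<le> q" "120 * L * N / \<epsilon> \<le> q"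
    and b: "40 * L * M - 5 \<le> b" "120 * L * N / \<epsilon> \<le> b" "60 * \<sigma>\<^sup>2 / \<epsilon> \<le> b"
    and d: "d \<le> M * g + N" and V: "V + g \<le> 4 * L * d + 2 * \<sigma>\<^sup>2"
  shows "5 * L / q * d + (g / 4 + 5 / (4 * b) * V) \<le> g / 2 + \<epsilon> / 8"
proof -
  have LN: "120 * (L * N) \<le> q * \<epsilon>" "120 * (L * N) \<le> b * \<epsilon>" "60 * \<sigma>\<^sup>2 \<le> b * \<epsilon>"
    using q b pos by (simp_all add: field_simps)
  have Ld: "L * d \<le> L * M * g + L * N"
    using mult_left_mono[OF d, of L] pos by (simp add: algebra_simps)
  have "40 * (L * M * g) \<le> q * g"
    using mult_right_mono[OF q(1) g] by (simp add: algebra_simps)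
  with Ld LN(1) have "5 * L * d \<le> q * (g / 8 + \<epsilon> / 24)"
    by (simp add: algebra_simps)
  then have 1: "5 * L / q * d \<le> g / 8 + \<epsilon> / 24"
    using pos by (simp add: field_simps)
  \<comment> \<open>Moving \<open>g\<close> to the right in \<open>V\<close> yields
    \<open>5 * V \<le> 20 * L * d - 5 * g + 10 * \<sigma>\<^sup>2\<close>; after inserting
    \<open>Ld\<close>, the part proportional to \<open>g\<close> is half of
    \<open>(40 * L * M - 10) * g\<close>.\<close>
  have "(40 * L * M - 10) * g \<le> b * g"
    using b(1) g by (intro mult_right_mono) auto
  with Ld V LN have "5 * V \<le> 4 * b * (g / 8 + \<epsilon> / 12)"
    by (simp add: algebra_simps)
  then have 2: "5 / (4 * b) * V \<le> g / 8 + \<epsilon> / 12"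
    using pos by (simp add: field_simps)
  from 1 2 show ?thesis by simp
qed

context isarah_run
begin

text \<open>The map sending \<open>a\<close> to \<open>a / 2 + \<epsilon> / 8\<close> has the fixed
  point \<open>\<epsilon> / 4\<close>, and the excess over it halves with each call.\<close>

lemma expected_gradient_le:
  fixes M N \<epsilon> :: real
  assumes \<epsilon>: "0 < \<epsilon>"
    and m: "40 * L * M \<le> real m + 1" "120 * L * N / \<epsilon> \<le> real m + 1"
    and b: "40 * L * M - 5 \<le> real b" "120 * L * N / \<epsilon> \<le> real b" "60 * \<sigma>\<^sup>2 / \<epsilon> \<le> real b"
    and gap_le: "AE \<omega> in P. \<forall>k\<le>T. gap (iterate k \<omega>) \<le> M * (norm (gradF (iterate k \<omega>)))\<^sup>2 + N"
  shows "k \<le> T \<Longrightarrow> (\<integral>\<^sup>+\<omega>. ennreal ((norm (gradF (iterate k \<omega>)))\<^sup>2) \<partial>P)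
    \<le> ennreal ((norm (gradF w0))\<^sup>2 / 2 ^ k + \<epsilon> / 4)"
proof (induction k)
  case 0
  show ?case
    using \<epsilon> by (simp add: iterate_0 P.emeasure_space_1 ennreal_leI)
next
  case (Suc k)
  let ?g = "\<lambda>\<omega>. (norm (gradF (iterate k \<omega>)))\<^sup>2"
  let ?a = "(norm (gradF w0))\<^sup>2 / 2 ^ k + \<epsilon> / 4"
  have k: "k < T" using Suc.prems by simp
  have half: "ennreal (1 / 2 * x + c) = ennreal (1 / 2) * ennreal x + ennreal c"
    if "0 \<le> x" "0 \<le> c" for x c
  proof -
    have "ennreal (1 / 2 * x) = ennreal (1 / 2) * ennreal x"
      using that by (intro ennreal_mult) auto
    moreover have "ennreal (1 / 2 * x + c) = ennreal (1 / 2 * x) + ennreal c"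
      using that by (intro ennreal_plus) auto
    ultimately show ?thesis by simp
  qed
  have [measurable]: "iterate k \<in> borel_measurable P"
    using k by (intro measurable_iterate_P) simp
  have "(\<integral>\<^sup>+\<omega>. ennreal ((norm (gradF (iterate (Suc k) \<omega>)))\<^sup>2) \<partial>P)
      \<le> (\<integral>\<^sup>+\<omega>. ennreal (5 * L / (real m + 1) * gap (iterate k \<omega>)
        + (?g \<omega> / 4 + 5 / (4 * real b) * noise_var (iterate k \<omega>))) \<partial>P)"
    by (rule expected_gradient_step[OF k])
  also have "\<dots> \<le> (\<integral>\<^sup>+\<omega>. ennreal (1 / 2) * ennreal (?g \<omega>) + ennreal (\<epsilon> / 8) \<partial>P)"
    using gap_le
  proof (intro nn_integral_mono_AE, eventually_elim)
    case (elim \<omega>)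
    then have "5 * L / (real m + 1) * gap (iterate k \<omega>)
        + (?g \<omega> / 4 + 5 / (4 * real b) * noise_var (iterate k \<omega>)) \<le> ?g \<omega> / 2 + \<epsilon> / 8"
      using k batch_pos by (intro step_constants[OF L_pos \<epsilon> _ _ _ m b _ noise_var_le]) auto
    then have "ennreal (5 * L / (real m + 1) * gap (iterate k \<omega>)
        + (?g \<omega> / 4 + 5 / (4 * real b) * noise_var (iterate k \<omega>))) \<le> ennreal (1 / 2 * ?g \<omega> + \<epsilon> / 8)"
      by (intro ennreal_leI) simp
    also have "\<dots> = ennreal (1 / 2) * ennreal (?g \<omega>) + ennreal (\<epsilon> / 8)"
      using \<epsilon> by (intro half) auto
    finally show ?case .
  qed
  also have "\<dots> = ennreal (1 / 2) * (\<integral>\<^sup>+\<omega>. ennreal (?g \<omega>) \<partial>P) + ennreal (\<epsilon> / 8)"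
    by (subst nn_integral_add) (simp_all add: nn_integral_cmult P.emeasure_space_1)
  also have "\<dots> \<le> ennreal (1 / 2) * ennreal ?a + ennreal (\<epsilon> / 8)"
    using Suc.IH k by (intro add_mono mult_left_mono) auto
  also have "\<dots> = ennreal (1 / 2 * ?a + \<epsilon> / 8)"
    using \<epsilon> by (intro half[symmetric]) auto
  also have "1 / 2 * ?a + \<epsilon> / 8 = (norm (gradF w0))\<^sup>2 / 2 ^ Suc k + \<epsilon> / 4"
    by (simp add: field_simps)
  finally show ?case .
qed

end

section \<open>Work complexity\<close>

lemma isarah_m_ge:
  "40 * L * M \<le> real (isarah_m L M N \<epsilon>) + 1" "120 * L * N / \<epsilon> \<le> real (isarah_m L M N \<epsilon>) + 1"
  using real_nat_ceiling_ge[of "max (40 * L * M - 1) (120 * L * N / \<epsilon> - 1)"]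
  by (simp_all add: isarah_m_def)

lemma isarah_b_ge:
  "40 * L * M - 5 \<le> real (isarah_b L M N \<sigma> \<epsilon>)" "120 * L * N / \<epsilon> \<le> real (isarah_b L M N \<sigma> \<epsilon>)"
  "60 * \<sigma>\<^sup>2 / \<epsilon> \<le> real (isarah_b L M N \<sigma> \<epsilon>)"
  using real_nat_ceiling_ge[of "max (40 * L * M - 5) (max (120 * L * N / \<epsilon>) (60 * \<sigma>\<^sup>2 / \<epsilon>))"]
  by (simp_all add: isarah_b_def)

text \<open>The condition \<open>\<epsilon> \<le> \<sigma>\<^sup>2\<close> makes the maximum
  \<open>X\<close> at least 1, so both rounding errors are absorbed:
  \<open>2 * (120 * X + 1) \<le> 242 * X\<close>.\<close>

lemma isarah_work_le:
  fixes L M N \<sigma> \<epsilon> :: real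
  assumes "0 < L" "0 < M" "0 < N" "0 < \<epsilon>" "\<epsilon> \<le> \<sigma>\<^sup>2"
  shows "real (isarah_b L M N \<sigma> \<epsilon> + isarah_m L M N \<epsilon>) \<le> 242 * max (L * M) (max (L * N) (\<sigma>\<^sup>2) / \<epsilon>)"
proof -
  define X where "X = max (L * M) (max (L * N) (\<sigma>\<^sup>2) / \<epsilon>)"
  have X: "L * M \<le> X" "L * N / \<epsilon> \<le> X" "\<sigma>\<^sup>2 / \<epsilon> \<le> X"
    using assms by (auto simp: X_def le_max_iff_disj max_divide_distrib_right)
  have "1 \<le> \<sigma>\<^sup>2 / \<epsilon>" using assms by simp
  with X have X1: "1 \<le> X" by linarith
  \<comment> \<open>For negative \<open>y\<close> the conversion \<open>nat\<close> returns
    0.\<close>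
  have "real (nat \<lceil>y\<rceil>) \<le> 120 * X + 1" if "y \<le> 120 * X" for y :: real
    using that X1 by (cases "0 \<le> y") (linarith, simp)
  then have "real (isarah_b L M N \<sigma> \<epsilon>) \<le> 120 * X + 1" "real (isarah_m L M N \<epsilon>) \<le> 120 * X + 1"
    unfolding isarah_b_def isarah_m_def using X X1 by simp_all
  with X1 show ?thesis by (simp add: X_def[symmetric])
qed

text \<open>The factor 2 in \<open>s\<close> gives
  \<open>1 / 2 ^ s \<le> \<epsilon>\<^sup>2\<close>, so \<open>G\<close> affects only how small
  \<open>\<epsilon>\<close> must be and not \<open>s\<close> as a function of
  \<open>\<epsilon>\<close>.\<close>

lemma outer_iterations_bounds:
  fixes \<epsilon> G :: real
  defines "s \<equiv> nat \<lceil>2 * log 2 (1 / \<epsilon>)\<rceil>"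
  assumes "0 < \<epsilon>" "\<epsilon> \<le> exp (- 1)" "\<epsilon> \<le> 3 / (4 * (\<bar>G\<bar> + 1))"
  shows "real s \<le> 4 * ln (1 / \<epsilon>)" "G / 2 ^ s + \<epsilon> / 4 \<le> \<epsilon>"
proof -
  \<comment> \<open>Lets one multiple of \<open>ln (1 / \<epsilon>)\<close> absorb the rounding of
    \<open>s\<close>; the other three come from \<open>ln 2\<close> being at least
    \<open>2 / 3\<close>.\<close>
  have ln1: "1 \<le> ln (1 / \<epsilon>)"
    using assms by (simp add: ln_div ln_le_cancel_iff[of \<epsilon> "exp (- 1)", symmetric] del: ln_le_cancel_iff)
  have "ln (1 / \<epsilon>) * (2 / 3) \<le> ln (1 / \<epsilon>) * ln 2"
    using ln1 ln2_ge_two_thirds by (intro mult_left_mono) auto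
  then have "2 * log 2 (1 / \<epsilon>) \<le> 3 * ln (1 / \<epsilon>)"
    by (simp add: log_def divide_le_eq)
  moreover have "0 \<le> 2 * log 2 (1 / \<epsilon>)"
    using ln1 by (simp add: log_def)
  ultimately show "real s \<le> 4 * ln (1 / \<epsilon>)"
    using ln1 unfolding s_def by linarith
  have "(1 / \<epsilon>)\<^sup>2 = 2 powr (log 2 (1 / \<epsilon>) + log 2 (1 / \<epsilon>))"
    unfolding powr_add using assms by (simp add: power2_eq_square)
  also have "\<dots> = 2 powr (2 * log 2 (1 / \<epsilon>))"
    by (simp only: mult_2)
  also have "\<dots> \<le> 2 powr real s"
    unfolding s_def by (intro powr_mono real_nat_ceiling_ge) auto
  also have "\<dots> = 2 ^ s" by (simp add: powr_realpow)
  finally have "1 / 2 ^ s \<le> \<epsilon>\<^sup>2"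
    using assms by (simp add: field_simps)
  then have "\<bar>G\<bar> * (1 / 2 ^ s) \<le> \<bar>G\<bar> * \<epsilon>\<^sup>2"
    by (intro mult_left_mono) auto
  moreover have "G / 2 ^ s \<le> \<bar>G\<bar> * (1 / 2 ^ s)"
    by (simp add: divide_right_mono)
  moreover have "\<bar>G\<bar> * \<epsilon>\<^sup>2 \<le> 3 / 4 * \<epsilon>"
  proof -
    have "(\<bar>G\<bar> + 1) * \<epsilon> \<le> 3 / 4"
      using assms(4) by (simp add: field_simps add_pos_nonneg)
    then have "\<bar>G\<bar> * \<epsilon> \<le> 3 / 4"
      using assms(2) by (simp add: algebra_simps)
    then have "\<bar>G\<bar> * \<epsilon> * \<epsilon> \<le> 3 / 4 * \<epsilon>"
      using assms(2) by (intro mult_right_mono) auto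
    then show ?thesis by (simp add: power2_eq_square)
  qed
  ultimately show "G / 2 ^ s + \<epsilon> / 4 \<le> \<epsilon>" by linarith
qed

text \<open>The order of quantifiers lets \<open>C\<close> depend on \<open>G\<close> only, and
  \<open>s\<close> is chosen before the objective and the randomness, hence works for all of them.
  Integrability is part of the conclusion, since otherwise the integral could be 0 by
  default.\<close>

theorem corollary5:
  fixes G :: real
  shows "\<exists>C>0. \<forall>L>0. \<forall>M>0. \<forall>N>0. \<forall>\<sigma>>0. \<exists>\<epsilon>0>0. \<forall>\<epsilon>. 0 < \<epsilon> \<and> \<epsilon> < \<epsilon>0 \<longrightarrow>
    (let \<eta> = 2 / (5 * L); m = isarah_m L M N \<epsilon>; b = isarah_b L M N \<sigma> \<epsilon> in
     \<exists>s::nat.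
       real ((b + m) * s) \<le> C * (max (L * M) (max (L * N) (\<sigma>\<^sup>2) / \<epsilon>) * ln (1 / \<epsilon>)) \<and>
       (\<forall>(D :: 'x measure) (f :: 'd::euclidean_space \<Rightarrow> 'x \<Rightarrow> real) wstar w0
          (P :: 'w measure) \<zeta> \<xi> \<tau> T.
          stochastic_objective D f \<and>
          (\<forall>x\<in>space D. convex_on UNIV (\<lambda>w. f w x)) \<and>
          (\<forall>x\<in>space D. \<forall>w w'. norm (sgrad f w x - sgrad f w' x) \<le> L * norm (w - w')) \<and>
          (\<forall>w. objective D f wstar \<le> objective D f w) \<and>
          integrable D (\<lambda>x. (norm (sgrad f wstar x))\<^sup>2) \<and>
          (\<integral>x. (norm (sgrad f wstar x))\<^sup>2 \<partial>D) \<le> \<sigma>\<^sup>2 \<and>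
          (norm (grad (objective D f) w0))\<^sup>2 = G \<and>
          isarah_randomness P D m b T \<zeta> \<xi> \<tau> \<and>
          s \<le> T \<and>
          (AE \<omega> in P. \<forall>k\<le>T.
             objective D f (isarah_iterate f \<eta> b \<zeta> \<xi> \<tau> w0 k \<omega>) - objective D f wstar
               \<le> M * (norm (grad (objective D f) (isarah_iterate f \<eta> b \<zeta> \<xi> \<tau> w0 k \<omega>)))\<^sup>2 + N)
          \<longrightarrow>
          integrable P
            (\<lambda>\<omega>. (norm (grad (objective D f) (isarah_iterate f \<eta> b \<zeta> \<xi> \<tau> w0 s \<omega>)))\<^sup>2) \<and>
          (\<integral>\<omega>. (norm (grad (objective D f) (isarah_iterate f \<eta> b \<zeta> \<xi> \<tau> w0 s \<omega>)))\<^sup>2 \<partial>P)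
            \<le> \<epsilon>))"
  unfolding Let_def
\<comment> \<open>\<open>968 = 242 * 4\<close>, with the factors from \<open>isarah_work_le\<close>
  and \<open>outer_iterations_bounds\<close>.\<close>
proof (rule exI[of _ "968 :: real"], intro conjI allI impI, goal_cases)
  case 1
  show ?case by simp
next
  case (2 L M N \<sigma>)
  then have pos: "0 < L" "0 < M" "0 < N" "0 < \<sigma>" by auto
  \<comment> \<open>The first bound serves \<open>isarah_work_le\<close>, the other two
    \<open>outer_iterations_bounds\<close>; \<open>\<bar>G\<bar> + 1\<close> avoids a zero
    denominator.\<close>
  let ?\<epsilon>0 = "min (\<sigma>\<^sup>2) (min (exp (- 1)) (3 / (4 * (\<bar>G\<bar> + 1))))"
  show ?case
  proof (rule exI[of _ ?\<epsilon>0], intro conjI allI impI, goal_cases)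
    case 1
    show ?case using pos by (simp add: add_nonneg_pos)
  next
    case (2 \<epsilon>)
    define s where "s = nat \<lceil>2 * log 2 (1 / \<epsilon>)\<rceil>"
    define b where "b = isarah_b L M N \<sigma> \<epsilon>"
    define m where "m = isarah_m L M N \<epsilon>"
    have \<epsilon>: "0 < \<epsilon>" "\<epsilon> \<le> \<sigma>\<^sup>2" "\<epsilon> \<le> exp (- 1)" "\<epsilon> \<le> 3 / (4 * (\<bar>G\<bar> + 1))"
      using 2 by auto
    note s = outer_iterations_bounds[OF \<epsilon>(1,3,4), folded s_def]
    show ?case
      unfolding b_def[symmetric] m_def[symmetric]
    proof (rule exI[of _ s], rule conjI, goal_cases)
      case 1
      have "real (b + m) * real s
          \<le> (242 * max (L * M) (max (L * N) (\<sigma>\<^sup>2) / \<epsilon>)) * (4 * ln (1 / \<epsilon>))"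
        unfolding b_def m_def using pos \<epsilon> s(1)
        by (intro mult_mono isarah_work_le) (auto simp: le_max_iff_disj)
      then show ?case by simp
    next
      case 2
      show ?case
      proof (intro allI impI, goal_cases)
        case (1 D f wstar w0 P \<zeta> \<xi> \<tau> T)
        have "0 < 60 * \<sigma>\<^sup>2 / \<epsilon>" using pos \<epsilon> by simp
        also have "\<dots> \<le> real b" unfolding b_def by (rule isarah_b_ge)
        finally have "0 < b" by simp
        interpret isarah_run D f L \<sigma> wstar P m b T \<zeta> \<xi> \<tau> w0
          using 1 pos \<open>0 < b\<close>
          by (intro isarah_run.intro smooth_convex_objective.intro smooth_convex_objective_axioms.intro
              isarah_run_axioms.intro) auto
        have gap_le: "AE \<omega> in P. \<forall>k\<le>T. gap (iterate k \<omega>) \<le> M * (norm (gradF (iterate k \<omega>)))\<^sup>2 + N"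
          using 1 unfolding gap_def grad_objective by blast
        have sT: "s \<le> T" and G: "(norm (gradF w0))\<^sup>2 = G"
          using 1 unfolding grad_objective by blast+
        have [measurable]: "iterate s \<in> borel_measurable P"
          by (rule measurable_iterate_P[OF sT])
        have "(\<integral>\<^sup>+\<omega>. ennreal ((norm (gradF (iterate s \<omega>)))\<^sup>2) \<partial>P) \<le> ennreal (G / 2 ^ s + \<epsilon> / 4)"
          using expected_gradient_le[OF \<epsilon>(1) isarah_m_ge[where L = L and M = M and N = N and \<epsilon> = \<epsilon>, folded m_def]
              isarah_b_ge[where L = L and M = M and N = N and \<epsilon> = \<epsilon> and \<sigma> = \<sigma>, folded b_def] gap_le sT]
          unfolding G .
        also have "\<dots> \<le> ennreal \<epsilon>"
          using s(2) by (rule ennreal_leI)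
        finally have le: "(\<integral>\<^sup>+\<omega>. ennreal ((norm (gradF (iterate s \<omega>)))\<^sup>2) \<partial>P) \<le> ennreal \<epsilon>" .
        \<comment> \<open>Finiteness of the nonnegative integral yields integrability, after which
          the estimate transfers to the Bochner integral of the claim.\<close>
        have int: "integrable P (\<lambda>\<omega>. (norm (gradF (iterate s \<omega>)))\<^sup>2)"
          using le_less_trans[OF le ennreal_less_top] by (intro integrableI_nonneg) auto
        have "ennreal (\<integral>\<omega>. (norm (gradF (iterate s \<omega>)))\<^sup>2 \<partial>P) \<le> ennreal \<epsilon>"
          using le by (subst (asm) nn_integral_eq_integral[OF int]) auto
        then have "(\<integral>\<omega>. (norm (gradF (iterate s \<omega>)))\<^sup>2 \<partial>P) \<le> \<epsilon>"
          using \<epsilon> by simp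
        with int show ?case
          unfolding grad_objective by blast
      qed
    qed
  qed
qed

end
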